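(* For any positive integer $n$ and any subset $S\subseteq[n-1]=\{1,2,\dots,n-1\}$, there exists a bijection $$f_S:\{\pi\in\mathfrak{S}^o_n:\operatorname{Asc}(\pi)\subseteq S\}\to\{\pi\in\mathfrak{S}^e_n:\operatorname{Des}(\pi)\subseteq S\}.$$
   Context: $\mathfrak{S}_n$ is the symmetric group on $[n]=\{1,\dots,n\}$, with permutations written in one-line notation $\pi=\pi_1\pi_2\cdots\pi_n$. $\mathfrak{S}^o_n$ is the set of permutations in $\mathfrak{S}_n$ all of whose cycles have odd length. $\mathfrak{S}^e_n$ is the set of permutations in $\mathfrak{S}_n$ all of whose cycles have even length, except possibly for one cycle of length one (a fixed point). For $\pi\in\mathfrak{S}_n$, $\operatorname{Des}(\pi)=\{i\in[n-1]:\pi_i>\pi_{i+1}\}$ and $\operatorname{Asc}(\pi)=\{i\in[n-1]:\pi_i<\pi_{i+1}\}$. *)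

theory Defs
  imports "HOL-Combinatorics.Combinatorics"
begin

definition perms :: "nat \<Rightarrow> (nat \<Rightarrow> nat) set" where
  "perms n = {p. p permutes {1..n}}"

definition cycle_len :: "(nat \<Rightarrow> nat) \<Rightarrow> nat \<Rightarrow> nat" where
  "cycle_len p x = card (orbit p x)"

definition odd_perms :: "nat \<Rightarrow> (nat \<Rightarrow> nat) set" where
  "odd_perms n = {p \<in> perms n. \<forall>x\<in>{1..n}. odd (cycle_len p x)}"

definition even_perms :: "nat \<Rightarrow> (nat \<Rightarrow> nat) set" where
  "even_perms n = {p \<in> perms n.
      (\<forall>x\<in>{1..n}. even (cycle_len p x) \<or> cycle_len p x = 1) \<and>
      card {x\<in>{1..n}. cycle_len p x = 1} \<le> 1}"

definition Des :: "nat \<Rightarrow> (nat \<Rightarrow> nat) \<Rightarrow> nat set" where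
  "Des n p = {i\<in>{1..n-1}. p i > p (Suc i)}"

definition Asc :: "nat \<Rightarrow> (nat \<Rightarrow> nat) \<Rightarrow> nat set" where
  "Asc n p = {i\<in>{1..n-1}. p i < p (Suc i)}"

end

theory Submission
  imports Defs "HOL-Library.List_Lexorder" "HOL-Library.Infinite_Set"
begin

text \<open>Split \<open>{1..n}\<close> into blocks by cutting after each element of \<open>S\<close>, and read off, for every \<open>i\<close>, the
  infinite word of blocks visited by \<open>i, \<pi> i, \<pi>\<^sup>2 i, \<dots>\<close>. The multiset of these words is invariant under
  the shift, so it encodes a multiset of primitive necklaces, and its first letters have the block
  sizes as multiplicities. If \<open>\<pi>\<close> increases on blocks (\<open>Des \<pi> \<subseteq> S\<close>), the words are sorted
  lexicographically and \<open>\<pi>\<close> can be recovered (Gessel--Reutenauer); if \<open>\<pi>\<close> decreases on blocks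
  (\<open>Asc \<pi> \<subseteq> S\<close>) and has only odd cycles, the words are distinct, sorted in the alternating
  lexicographic order, and again \<open>\<pi>\<close> can be recovered.

  It remains to count necklaces by content. Let \<open>p\<close> be the sum of the letters and let \<open>N\<close> range over
  primitive necklaces. All permutations increasing on blocks correspond to words, so
  \<open>\<Prod>\<^sub>N 1/(1 - x\<^sup>N) = 1/(1 - p)\<close>. Changing the sign of all letters gives
  \<open>\<Prod>\<^bsub>N even\<^esub> 1/(1 - x\<^sup>N) \<cdot> \<Prod>\<^bsub>N odd\<^esub> 1/(1 + x\<^sup>N) = 1/(1 + p)\<close>, that is,
  \<open>\<Prod>\<^bsub>N odd\<^esub> (1 + x\<^sup>N) = (1 + p) \<cdot> \<Prod>\<^bsub>N even\<^esub> 1/(1 - x\<^sup>N)\<close>: sets of odd necklaces are equinumerous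
  with multisets of even necklaces together with at most one letter.\<close>

section \<open>Sorting and matching on finite intervals\<close>

text \<open>Along the increasing enumeration of \<open>A\<close> both value lists are sorted, and a
  sorted list is determined by its multiset.\<close>

lemma mono_on_eq_of_image_mset_eq:
  fixes F G :: "'a::linorder \<Rightarrow> 'b::linorder"
  assumes "finite A" "mono_on A F" "mono_on A G"
    and "image_mset F (mset_set A) = image_mset G (mset_set A)" and "x \<in> A"
  shows "F x = G x"
proof -
  let ?xs = "sorted_list_of_set A"
  have "mset ?xs = mset_set A"
    by (metis mset_sorted_list_of_multiset sorted_list_of_mset_set)
  then have *: "mset (map F ?xs) = mset (map G ?xs)"
    using assms by simp
  have sorted_H: "sorted (map H ?xs)" if "mono_on A H" for H :: "'a \<Rightarrow> 'b"
    unfolding sorted_map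
    by (rule sorted_wrt_mono_rel[OF _ sorted_sorted_list_of_set]) (use that assms(1) in \<open>auto dest: mono_onD\<close>)
  have "map F ?xs = map G ?xs"
    using properties_for_sort[OF * sorted_H[OF assms(2)]]
      properties_for_sort[OF refl sorted_H[OF assms(3)]] by simp
  then show ?thesis
    using assms(1,5) by simp
qed

lemma exists_mono_on_enumeration:
  fixes K :: "'a \<Rightarrow> 'b::linorder"
  obtains s :: "nat \<Rightarrow> 'a"
  where "image_mset s (mset_set {1..size M}) = M" "mono_on {1..size M} (K \<circ> s)"
proof -
  obtain xs0 where "mset xs0 = M" using ex_mset by blast
  define xs where "xs = sort_key K xs0"
  have xs: "mset xs = M" "sorted (map K xs)" "length xs = size M"
    using \<open>mset xs0 = M\<close> by (auto simp: xs_def simp flip: size_mset)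
  have "image_mset (\<lambda>i. xs ! (i - 1)) (mset_set {1..size M}) = image_mset (\<lambda>i. xs ! i) (mset_set {0..<size M})"
  proof -
    have "mset_set {1..size M} = image_mset Suc (mset_set {0..<size M})"
      by (subst image_mset_mset_set) (auto simp: image_Suc_atLeastLessThan atLeastLessThanSuc_atLeastAtMost)
    then show ?thesis by (simp add: image_mset.compositionality comp_def)
  qed
  also have "\<dots> = mset (map ((!) xs) [0..<length xs])"
    using xs(3) by simp
  also have "\<dots> = M"
    using xs(1) by (simp only: map_nth)
  finally have 1: "image_mset (\<lambda>i. xs ! (i - 1)) (mset_set {1..size M}) = M" .
  have 2: "mono_on {1..size M} (K \<circ> (\<lambda>i. xs ! (i - 1)))"
  proof (rule mono_onI)
    fix i j assume "i \<in> {1..size M}" "j \<in> {1..size M}" "i \<le> j"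
    then show "(K \<circ> (\<lambda>i. xs ! (i - 1))) i \<le> (K \<circ> (\<lambda>i. xs ! (i - 1))) j"
      using sorted_nth_mono[OF xs(2), of "i - 1" "j - 1"] xs(3) by auto
  qed
  show ?thesis using that 1 2 by blast
qed

lemma exists_strict_mono_bij:
  fixes F G :: "nat set"
  assumes "finite F" "finite G" "card F = card G"
  shows "\<exists>h. bij_betw h F G \<and> strict_mono_on F h"
proof -
  obtain f where f: "bij_betw f {..<card F} F" "strict_mono_on {..<card F} f"
    using ex_bij_betw_strict_mono_card[OF assms(1)] by blast
  obtain g where g: "bij_betw g {..<card G} G" "strict_mono_on {..<card G} g"
    using ex_bij_betw_strict_mono_card[OF assms(2)] by blast
  let ?f' = "the_inv_into {..<card F} f"
  have f': "bij_betw ?f' F {..<card F}"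
    using f(1) by (rule bij_betw_the_inv_into)
  have inv: "f (?f' x) = x" if "x \<in> F" for x
    using f(1) that by (simp add: bij_betw_def f_the_inv_into_f)
  have "strict_mono_on F ?f'"
  proof (rule strict_mono_onI)
    fix r s assume rs: "r \<in> F" "s \<in> F" "r < s"
    then have "?f' r \<in> {..<card F}" "?f' s \<in> {..<card F}"
      using f' by (auto simp: bij_betw_def)
    then show "?f' r < ?f' s"
      using strict_mono_on_leD[OF f(2), of "?f' s" "?f' r"] inv rs by (metis leD leI)
  qed
  then have "strict_mono_on F (g \<circ> ?f')"
    using g(2) f' assms(3) unfolding strict_mono_on_def bij_betw_def comp_def
    by (metis image_eqI)
  moreover have "bij_betw (g \<circ> ?f') F G"
    using bij_betw_trans[OF f'] g(1) assms(3) by metis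
  ultimately show ?thesis by blast
qed

text \<open>Equality of the multisets says that over each \<open>k\<close> the fibres of
  \<open>f\<close> and \<open>g\<close> have the same size; order-preserving bijections between the
  fibres are glued. This rebuilds a permutation from its words.\<close>

lemma exists_fibrewise_increasing_matching:
  fixes f g :: "nat \<Rightarrow> 'a"
  assumes "finite A" and eq: "image_mset f (mset_set A) = image_mset g (mset_set A)"
  shows "\<exists>p. p permutes A \<and> (\<forall>i\<in>A. g (p i) = f i) \<and>
    (\<forall>i\<in>A. \<forall>j\<in>A. i < j \<longrightarrow> f i = f j \<longrightarrow> p i < p j)"
proof -
  let ?F = "\<lambda>k. {i\<in>A. f i = k}" and ?G = "\<lambda>k. {i\<in>A. g i = k}"
  have "card (?F k) = card (?G k)" for k
  proof -
    have "card (?F k) = size (filter_mset (\<lambda>x. x = k) (image_mset f (mset_set A)))"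
      using assms(1) by (simp add: filter_mset_image_mset)
    also have "\<dots> = card (?G k)"
      using assms(1) by (simp add: eq filter_mset_image_mset)
    finally show ?thesis .
  qed
  then have "\<exists>h. bij_betw h (?F k) (?G k) \<and> strict_mono_on (?F k) h" for k
    by (intro exists_strict_mono_bij) (use assms(1) in auto)
  then have "\<forall>k. \<exists>h. bij_betw h (?F k) (?G k) \<and> strict_mono_on (?F k) h"
    by blast
  from choice[OF this] obtain h
    where h: "\<And>k. bij_betw (h k) (?F k) (?G k)" "\<And>k. strict_mono_on (?F k) (h k)"
    by blast
  define p where "p = (\<lambda>i. if i \<in> A then h (f i) i else i)"
  have p: "p i \<in> A" "g (p i) = f i" if "i \<in> A" for i
    using h(1)[of "f i"] that by (auto simp: p_def bij_betw_def)
  have "inj_on p A"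
  proof (rule inj_onI)
    fix i j assume ij: "i \<in> A" "j \<in> A" "p i = p j"
    then have "f i = f j" using p(2) by metis
    with ij h(1)[of "f i"] show "i = j"
      by (auto simp: p_def bij_betw_def inj_on_def)
  qed
  then have "bij_betw p A A"
    using p(1) endo_inj_surj[OF assms(1), of p] by (auto simp: bij_betw_def)
  then have "p permutes A"
    by (rule bij_imp_permutes) (simp add: p_def)
  moreover have "p i < p j" if "i \<in> A" "j \<in> A" "i < j" "f i = f j" for i j
    using strict_mono_onD[OF h(2)[of "f i"], of i j] that by (simp add: p_def)
  ultimately show ?thesis using p by blast
qed

text \<open>At the smallest disagreement, say \<open>p i < q i\<close>, the value \<open>p i\<close>
  equals \<open>q j\<close> for some \<open>j\<close> in the fibre of \<open>i\<close>;
  \<open>i < j\<close> contradicts monotonicity of \<open>q\<close> on the fibre, and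
  \<open>j < i\<close> gives \<open>p j = p i\<close>.\<close>

lemma fibrewise_increasing_matching_unique:
  fixes f g :: "nat \<Rightarrow> 'a"
  assumes p: "p permutes A" "\<forall>i\<in>A. g (p i) = f i"
      "\<forall>i\<in>A. \<forall>j\<in>A. i < j \<longrightarrow> f i = f j \<longrightarrow> p i < p j"
    and q: "q permutes A" "\<forall>i\<in>A. g (q i) = f i"
      "\<forall>i\<in>A. \<forall>j\<in>A. i < j \<longrightarrow> f i = f j \<longrightarrow> q i < q j"
  shows "p = q"
proof -
  have aux: "\<not> p i < q i"
    if i: "i \<in> A" and eq: "\<forall>j<i. p j = q j" and p: "p permutes A" "\<forall>i\<in>A. g (p i) = f i"
      and q: "q permutes A" "\<forall>i\<in>A. g (q i) = f i"
        "\<forall>i\<in>A. \<forall>j\<in>A. i < j \<longrightarrow> f i = f j \<longrightarrow> q i < q j"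
    for i and p q :: "nat \<Rightarrow> nat"
  proof
    assume less: "p i < q i"
    have "p i \<in> q ` A"
      using i permutes_image[OF q(1)] permutes_in_image[OF p(1)] by simp
    then obtain j where j: "j \<in> A" "q j = p i" by force
    then have f: "f j = f i" using p(2) q(2) i by metis
    have "\<not> i < j" "i \<noteq> j"
      using q(3) f i j less by fastforce+
    then have "j < i" by simp
    then have "p j = p i" using eq j by simp
    then show False
      using \<open>j < i\<close> permutes_inj[OF p(1)] by (auto dest: injD)
  qed
  have "p i = q i" for i
  proof (induction i rule: less_induct)
    case (less i)
    show ?case
    proof (cases "i \<in> A")
      case True
      have "\<not> p i < q i" by (rule aux) (use True less p q in auto)
      moreover have "\<not> q i < p i" by (rule aux) (use True less p q in auto)
      ultimately show ?thesis by simp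
    next
      case False
      then show ?thesis using p(1) q(1) by (simp add: permutes_not_in)
    qed
  qed
  then show ?thesis by auto
qed

section \<open>Itineraries and the lexicographic order on words\<close>

definition shift :: "(nat \<Rightarrow> 'a) \<Rightarrow> nat \<Rightarrow> 'a" where
  "shift u = (\<lambda>k. u (Suc k))"

definition itinerary :: "('b \<Rightarrow> 'a) \<Rightarrow> ('b \<Rightarrow> 'b) \<Rightarrow> 'b \<Rightarrow> nat \<Rightarrow> 'a" where
  "itinerary c p i = (\<lambda>k. c ((p ^^ k) i))"

text \<open>The sign lets permutations increasing on blocks and permutations decreasing on blocks
  share one theory; \<open>c\<close> is the block label.\<close>

definition block_mono :: "int \<Rightarrow> nat set \<Rightarrow> (nat \<Rightarrow> 'a) \<Rightarrow> (nat \<Rightarrow> nat) \<Rightarrow> bool" where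
  "block_mono \<epsilon> A c p \<longleftrightarrow>
     (\<forall>i\<in>A. \<forall>j\<in>A. i < j \<longrightarrow> c i = c j \<longrightarrow> \<epsilon> * int (p i) < \<epsilon> * int (p j))"

text \<open>For \<open>\<epsilon> = 1\<close> comparing keys is the lexicographic order on prefixes; for \<open>\<epsilon> = -1\<close> it is the
  alternating lexicographic order, in which the comparison is reversed at every odd position.\<close>

primrec key :: "int \<Rightarrow> nat \<Rightarrow> (nat \<Rightarrow> nat) \<Rightarrow> int list" where
  "key \<epsilon> 0 u = []"
| "key \<epsilon> (Suc N) u = int (u 0) # map ((*) \<epsilon>) (key \<epsilon> N (shift u))"

lemma funpow_shift: "(shift ^^ d) u = (\<lambda>k. u (d + k))"
  by (induction d arbitrary: u) (auto simp: shift_def)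

lemma itinerary_0 [simp]: "itinerary c p i 0 = c i"
  by (simp add: itinerary_def)

lemma shift_itinerary: "shift (itinerary c p i) = itinerary c p (p i)"
  by (simp add: shift_def itinerary_def funpow_swap1)

lemma funpow_shift_itinerary: "(shift ^^ d) (itinerary c p i) = itinerary c p ((p ^^ d) i)"
  by (simp add: funpow_shift itinerary_def funpow_add add.commute)

lemma length_key [simp]: "length (key \<epsilon> N u) = N"
  by (induction N arbitrary: u) auto

lemma key_eqD:
  assumes "\<epsilon> \<noteq> 0" "key \<epsilon> N u = key \<epsilon> N v" "k < N"
  shows "u k = v k"
  using assms(2,3)
proof (induction N arbitrary: u v k)
  case (Suc N)
  have "inj ((*) \<epsilon>)" using assms(1) by (simp add: inj_def)
  then have *: "u 0 = v 0" "key \<epsilon> N (shift u) = key \<epsilon> N (shift v)"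
    using Suc.prems(1) by (auto dest: map_injective)
  show ?case
    using * Suc.IH[OF *(2), of "k - 1"] Suc.prems(2) by (cases k) (auto simp: shift_def)
qed auto

text \<open>Equal lengths rule out proper prefixes, so the first difference decides, and negation
  reverses it.\<close>

lemma map_uminus_le_iff:
  fixes xs ys :: "int list"
  assumes "length xs = length ys"
  shows "map ((*) (-1)) xs \<le> map ((*) (-1)) ys \<longleftrightarrow> ys \<le> xs"
  using assms by (induction rule: list_induct2) auto

lemma map_sign_le_iff:
  fixes xs ys :: "int list"
  assumes "\<epsilon> = 1 \<or> \<epsilon> = -1" "length xs = length ys"
  shows "map ((*) \<epsilon>) xs \<le> map ((*) \<epsilon>) ys \<longleftrightarrow> (if \<epsilon> = 1 then xs \<le> ys else ys \<le> xs)"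
  using assms map_uminus_le_iff by (auto simp: map_idI[of _ "(*) 1"])

lemma key_Suc_le_iff:
  assumes "\<epsilon> = 1 \<or> \<epsilon> = -1"
  shows "key \<epsilon> (Suc N) u \<le> key \<epsilon> (Suc N) v \<longleftrightarrow>
    u 0 < v 0 \<or> u 0 = v 0 \<and>
      (if \<epsilon> = 1 then key \<epsilon> N (shift u) \<le> key \<epsilon> N (shift v)
       else key \<epsilon> N (shift v) \<le> key \<epsilon> N (shift u))"
  using map_sign_le_iff[OF assms] by (simp only: key.simps Cons_le_Cons) simp

text \<open>Truncation never reverses a comparison. For \<open>\<epsilon> = -1\<close> the tails are
  compared in the opposite order, so the induction hypothesis is also used with \<open>u\<close> and
  \<open>v\<close> swapped.\<close>

lemma key_le_prefix:
  assumes "\<epsilon> = 1 \<or> \<epsilon> = -1"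
  shows "key \<epsilon> (Suc N) u \<le> key \<epsilon> (Suc N) v \<Longrightarrow> key \<epsilon> N u \<le> key \<epsilon> N v"
proof (induction N arbitrary: u v)
  case (Suc N)
  have IH: "key \<epsilon> (Suc N) u \<le> key \<epsilon> (Suc N) v \<Longrightarrow> key \<epsilon> N u \<le> key \<epsilon> N v" for u v
    by (rule Suc.IH)
  have "u 0 < v 0 \<or> u 0 = v 0 \<and>
      (if \<epsilon> = 1 then key \<epsilon> (Suc N) (shift u) \<le> key \<epsilon> (Suc N) (shift v)
       else key \<epsilon> (Suc N) (shift v) \<le> key \<epsilon> (Suc N) (shift u))"
    using Suc.prems by (rule iffD1[OF key_Suc_le_iff[OF assms]])
  then have "u 0 < v 0 \<or> u 0 = v 0 \<and>
      (if \<epsilon> = 1 then key \<epsilon> N (shift u) \<le> key \<epsilon> N (shift v)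
       else key \<epsilon> N (shift v) \<le> key \<epsilon> N (shift u))"
    using IH[of "shift u" "shift v"] IH[of "shift v" "shift u"]
    by (auto split: if_splits simp del: key.simps)
  then show ?case by (rule iffD2[OF key_Suc_le_iff[OF assms]])
qed simp

text \<open>\<open>N\<close> exceeds a position of difference for each of the finitely many pairs in
  \<open>W\<close>, so comparing infinite words reduces to comparing finite keys.\<close>

lemma key_separates:
  assumes "finite W" "\<epsilon> \<noteq> 0"
  obtains N where "inj_on (key \<epsilon> N) W"
proof -
  have "\<forall>u v :: nat \<Rightarrow> nat. \<exists>k. u \<noteq> v \<longrightarrow> u k \<noteq> v k" by auto
  then obtain k where k: "\<And>u v :: nat \<Rightarrow> nat. u \<noteq> v \<Longrightarrow> u (k u v) \<noteq> v (k u v)" by metis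
  define N where "N = Suc (Max ((\<lambda>(u, v). k u v) ` (W \<times> W)))"
  have "inj_on (key \<epsilon> N) W"
  proof (rule inj_onI, rule ccontr)
    fix u v assume uv: "u \<in> W" "v \<in> W" "key \<epsilon> N u = key \<epsilon> N v" "u \<noteq> v"
    have "k u v \<in> (\<lambda>(u, v). k u v) ` (W \<times> W)"
      using uv by (force simp: image_iff)
    then have "k u v < N"
      using Max_ge[of "(\<lambda>(u, v). k u v) ` (W \<times> W)" "k u v"] assms(1) by (simp add: N_def le_imp_less_Suc)
    then show False using key_eqD[OF assms(2) uv(3)] k[OF uv(4)] by blast
  qed
  then show ?thesis using that by blast
qed

text \<open>If the first letters agree, the tails are the words of \<open>p i\<close> and
  \<open>p j\<close>; passing to these points reverses the order exactly when the comparison of keys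
  is reversed.\<close>

lemma key_itinerary_mono:
  assumes "\<epsilon> = 1 \<or> \<epsilon> = -1" "p permutes A" "mono_on A c" "block_mono \<epsilon> A c p"
    and "i \<in> A" "j \<in> A" "i < j"
  shows "key \<epsilon> N (itinerary c p i) \<le> key \<epsilon> N (itinerary c p j)"
  using assms(5-)
proof (induction N arbitrary: i j)
  case (Suc N)
  have "c i \<le> c j" using Suc.prems assms(3) by (auto dest: mono_onD)
  show ?case
  proof (cases "c i = c j")
    case True
    have pA: "p i \<in> A" "p j \<in> A" using Suc.prems permutes_in_image[OF assms(2)] by auto
    have "\<epsilon> * int (p i) < \<epsilon> * int (p j)"
      using assms(4) Suc.prems True by (simp add: block_mono_def)
    then show ?thesis
      using assms(1) True Suc.IH[OF pA] Suc.IH[OF pA(2,1)]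
      by (auto simp: key_Suc_le_iff shift_itinerary simp del: key.simps)
  next
    case False
    with \<open>c i \<le> c j\<close> show ?thesis by (simp add: key_Suc_le_iff[OF assms(1)] del: key.simps)
  qed
qed simp

text \<open>At every step both points lie in a common block, so each application of \<open>p\<close>
  changes their order by the factor \<epsilon>.\<close>

lemma block_mono_funpow:
  assumes "p permutes A" "block_mono \<epsilon> A c p" "i \<in> A" "j \<in> A" "i < j"
    and "itinerary c p i = itinerary c p j"
  shows "\<epsilon> ^ k * int ((p ^^ k) i) < \<epsilon> ^ k * int ((p ^^ k) j)"
proof (induction k)
  case (Suc k)
  let ?i = "(p ^^ k) i" and ?j = "(p ^^ k) j"
  have A: "?i \<in> A" "?j \<in> A"
    using assms(3,4) permutes_in_funpow_image[OF assms(1)] by auto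
  have c: "c ?i = c ?j"
    using fun_cong[OF assms(6), of k] by (simp add: itinerary_def)
  have "\<epsilon> ^ k \<noteq> 0" using Suc by (metis less_irrefl mult_zero_left)
  then have "\<epsilon> ^ k > 0 \<and> ?i < ?j \<or> \<epsilon> ^ k < 0 \<and> ?j < ?i"
    using Suc unfolding mult_less_cancel_left by linarith
  then consider "\<epsilon> ^ k > 0" "?i < ?j" | "\<epsilon> ^ k < 0" "?j < ?i" by blast
  then show ?case
  proof cases
    case 1
    then have "\<epsilon> * int (p ?i) < \<epsilon> * int (p ?j)"
      using assms(2) A c by (simp add: block_mono_def)
    then show ?thesis using 1(1) by (simp add: mult.assoc mult.left_commute[of \<epsilon>])
  next
    case 2
    then have "\<epsilon> * int (p ?j) < \<epsilon> * int (p ?i)"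
      using assms(2) A c by (simp add: block_mono_def)
    then show ?thesis using 2(1) by (simp add: mult.assoc mult.left_commute[of \<epsilon>])
  qed
qed (use assms(5) in simp)

section \<open>Shift-invariant multisets of words\<close>

text \<open>Invariance makes \<open>shift\<close> permute the finite support, so all words are
  periodic and the rotations of a necklace occur equally often; \<gamma> is the content of the
  necklaces.\<close>

definition shift_multisets :: "'a multiset \<Rightarrow> (nat \<Rightarrow> 'a) multiset set" where
  "shift_multisets \<gamma> = {M. image_mset shift M = M \<and> image_mset (\<lambda>u. u 0) M = \<gamma>}"

lemma inj_on_shift:
  assumes "image_mset shift M = M"
  shows "inj_on shift (set_mset M)"
proof -
  have "shift ` set_mset M = set_mset M"
    using assms by (metis set_image_mset)
  then show ?thesis by (intro eq_card_imp_inj_on) auto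
qed

text \<open>With \<open>\<epsilon> = 1\<close> this is the Gessel--Reutenauer correspondence, a multiset of primitive necklaces
  being encoded by the multiset of all infinite words read off from the letters of its necklaces.\<close>

lemma bij_betw_itineraries:
  fixes c :: "nat \<Rightarrow> nat"
  assumes \<epsilon>: "\<epsilon> = 1 \<or> \<epsilon> = -1" and c: "mono_on {1..n} c" "image_mset c (mset_set {1..n}) = \<gamma>"
  shows "bij_betw (\<lambda>p. image_mset (itinerary c p) (mset_set {1..n}))
    {p. p permutes {1..n} \<and> block_mono \<epsilon> {1..n} c p \<and> (\<epsilon> = 1 \<or> inj_on (itinerary c p) {1..n})}
    {M \<in> shift_multisets \<gamma>. \<epsilon> = 1 \<or> (\<forall>u. count M u \<le> 1)}"
    (is "bij_betw ?\<Phi> ?P ?Q")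
proof (rule bij_betw_imageI)
  let ?A = "{1..n}"
  have inv: "image_mset shift (?\<Phi> p) = ?\<Phi> p" if "p permutes ?A" for p
  proof -
    have "image_mset shift (?\<Phi> p) = image_mset (itinerary c p) (image_mset p (mset_set ?A))"
      by (simp add: image_mset.compositionality comp_def shift_itinerary)
    also have "image_mset p (mset_set ?A) = mset_set ?A"
      using that by (subst image_mset_mset_set) (auto simp: permutes_image permutes_inj_on)
    finally show ?thesis .
  qed
  have count1: "(\<forall>u. count (?\<Phi> p) u \<le> 1) \<longleftrightarrow> inj_on (itinerary c p) ?A" for p
  proof -
    have cnt: "count (?\<Phi> p) u = card {i \<in> ?A. itinerary c p i = u}" for u
    proof -
      have "count (?\<Phi> p) u = size (filter_mset (\<lambda>v. v = u) (?\<Phi> p))"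
        by (simp add: filter_eq_replicate_mset)
      then show ?thesis by (simp add: filter_mset_image_mset)
    qed
    have crd: "card {i \<in> ?A. itinerary c p i = u} \<le> 1 \<longleftrightarrow>
        (\<forall>i\<in>?A. \<forall>j\<in>?A. itinerary c p i = u \<longrightarrow> itinerary c p j = u \<longrightarrow> i = j)" for u
      using card_le_Suc0_iff_eq[of "{i \<in> ?A. itinerary c p i = u}"] unfolding One_nat_def
      by (simp del: atLeastAtMost_iff) blast
    show ?thesis unfolding cnt crd inj_on_def by blast
  qed
  have "?\<Phi> p \<in> ?Q" if p: "p \<in> ?P" for p
  proof -
    have "image_mset (\<lambda>u. u 0) (?\<Phi> p) = \<gamma>"
      using c(2) by (simp add: image_mset.compositionality comp_def)
    then have "?\<Phi> p \<in> shift_multisets \<gamma>"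
      using inv p by (simp add: shift_multisets_def)
    moreover have "\<epsilon> = 1 \<or> (\<forall>u. count (?\<Phi> p) u \<le> 1)"
      using p unfolding count1 by simp
    ultimately show ?thesis by simp
  qed
  then have sub: "?\<Phi> ` ?P \<subseteq> ?Q" by blast
  show "inj_on ?\<Phi> ?P"
  proof (rule inj_onI)
    fix p q assume p: "p \<in> ?P" and q: "q \<in> ?P" and eq: "?\<Phi> p = ?\<Phi> q"
    define s where "s = itinerary c p"
    have mono: "mono_on ?A (key \<epsilon> N \<circ> itinerary c r)" if "r \<in> ?P" for N r
    proof (rule mono_onI)
      fix i j assume "i \<in> ?A" "j \<in> ?A" "i \<le> j"
      then show "(key \<epsilon> N \<circ> itinerary c r) i \<le> (key \<epsilon> N \<circ> itinerary c r) j"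
        using that key_itinerary_mono[OF \<epsilon> _ c(1), of r i j N] by (cases "i = j") simp_all
    qed
    obtain N where N: "inj_on (key \<epsilon> N) (set_mset (?\<Phi> p))"
      by (rule key_separates[of "set_mset (?\<Phi> p)" \<epsilon>]) (use \<epsilon> in auto)
    \<comment> \<open>Both sequences of keys are monotone with the same multiset of values, hence
      equal; at length \<open>N\<close> the key determines the word.\<close>
    have s: "itinerary c q i = s i" if "i \<in> ?A" for i
    proof -
      have "(key \<epsilon> N \<circ> itinerary c p) i = (key \<epsilon> N \<circ> itinerary c q) i"
        by (rule mono_on_eq_of_image_mset_eq[OF _ mono[OF p] mono[OF q]])
          (use that eq in \<open>auto simp flip: image_mset.compositionality\<close>)
      moreover have "itinerary c p i \<in># ?\<Phi> p" "itinerary c q i \<in># ?\<Phi> q"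
        using that by auto
      ultimately show ?thesis unfolding s_def eq[symmetric]
        by (intro inj_onD[OF N]) simp_all
    qed
    \<comment> \<open>Given the words, \<open>p\<close> and \<open>q\<close> are both the fibrewise
      increasing matching of the words \<open>shift (s i)\<close> with the words \<open>s j\<close>.
      For \<open>\<epsilon> = -1\<close> the words are distinct and no ties occur.\<close>
    have match: "(\<forall>i\<in>?A. s (r i) = shift (s i)) \<and>
      (\<forall>i\<in>?A. \<forall>j\<in>?A. i < j \<longrightarrow> shift (s i) = shift (s j) \<longrightarrow> r i < r j)"
      if r: "r \<in> ?P" and rs: "\<And>i. i \<in> ?A \<Longrightarrow> itinerary c r i = s i" for r
    proof (intro conjI ballI impI)
      fix i assume i: "i \<in> ?A"
      then have "r i \<in> ?A" using r permutes_in_image[of r ?A i] by simp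
      then have "s (r i) = itinerary c r (r i)" by (rule rs[symmetric])
      also have "\<dots> = shift (s i)" by (simp only: rs[OF i, symmetric] shift_itinerary)
      finally show "s (r i) = shift (s i)" .
    next
      fix i j assume ij: "i \<in> ?A" "j \<in> ?A" "i < j" "shift (s i) = shift (s j)"
      have "inj_on shift (set_mset (?\<Phi> p))"
        using p inv by (intro inj_on_shift) auto
      then have "s i = s j"
        using ij unfolding inj_on_def s_def by auto
      then have it: "itinerary c r i = itinerary c r j" using rs ij by simp
      then have "\<epsilon> = 1" using r ij by (auto dest: inj_onD)
      moreover have "c i = c j" using it itinerary_0 by metis
      ultimately show "r i < r j" using r ij by (auto simp: block_mono_def)
    qed
    show "p = q"
    proof (rule fibrewise_increasing_matching_unique)
      show "p permutes ?A" "q permutes ?A" using p q by simp_all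
      have "itinerary c p i = s i" for i by (simp add: s_def)
      note mp = match[OF p this] and mq = match[OF q s]
      show "\<forall>i\<in>?A. s (p i) = shift (s i)" using mp by (rule conjunct1)
      show "\<forall>i\<in>?A. s (q i) = shift (s i)" using mq by (rule conjunct1)
      show "\<forall>i\<in>?A. \<forall>j\<in>?A. i < j \<longrightarrow> shift (s i) = shift (s j) \<longrightarrow> p i < p j"
        using mp by (rule conjunct2)
      show "\<forall>i\<in>?A. \<forall>j\<in>?A. i < j \<longrightarrow> shift (s i) = shift (s j) \<longrightarrow> q i < q j"
        using mq by (rule conjunct2)
    qed
  qed
  show "?\<Phi> ` ?P = ?Q"
  proof (rule antisym[OF sub], rule subsetI)
    fix M assume M: "M \<in> ?Q"
    then have invM: "image_mset shift M = M" and \<gamma>: "image_mset (\<lambda>u. u 0) M = \<gamma>"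
      by (auto simp: shift_multisets_def)
    have n: "size M = n"
      using arg_cong[OF \<gamma>, of size] arg_cong[OF c(2), of size] by simp
    obtain N where N: "inj_on (key \<epsilon> N) (set_mset M)"
      by (rule key_separates[of "set_mset M" \<epsilon>]) (use \<epsilon> in auto)
    \<comment> \<open>One letter more than \<open>N\<close>: dropping the first letter leaves keys
      of length \<open>N\<close>, which still separate the words.\<close>
    obtain s where s: "image_mset s (mset_set ?A) = M" "mono_on ?A (key \<epsilon> (Suc N) \<circ> s)"
      using exists_mono_on_enumeration[of M "key \<epsilon> (Suc N)"] n by metis
    have sM: "s i \<in># M" if "i \<in> ?A" for i using s(1) that by auto
    \<comment> \<open>Key order sorts the first letters, and their multiset is that of the values of
      \<open>c\<close>, so they agree with \<open>c\<close>.\<close>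
    have "mono_on ?A (\<lambda>i. s i 0)"
      using s(2) by (fastforce simp: mono_on_def key_Suc_le_iff[OF \<epsilon>] simp del: key.simps)
    moreover have "image_mset (\<lambda>i. s i 0) (mset_set ?A) = image_mset c (mset_set ?A)"
      using s(1) \<gamma> c(2) by (auto simp: image_mset.compositionality comp_def)
    ultimately have c_s: "c i = s i 0" if "i \<in> ?A" for i
      using mono_on_eq_of_image_mset_eq[OF _ c(1), of "\<lambda>i. s i 0" i] that by simp
    have "image_mset (\<lambda>i. shift (s i)) (mset_set ?A) = image_mset shift (image_mset s (mset_set ?A))"
      by (simp add: image_mset.compositionality comp_def)
    then have "image_mset (\<lambda>i. shift (s i)) (mset_set ?A) = image_mset s (mset_set ?A)"
      by (simp only: s(1) invM)
    \<comment> \<open>\<open>p i\<close> is a position carrying the word \<open>shift (s i)\<close>;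
      equal words are matched from left to right.\<close>
    then obtain p where p: "p permutes ?A" "\<And>i. i \<in> ?A \<Longrightarrow> s (p i) = shift (s i)"
        "\<And>i j. i \<in> ?A \<Longrightarrow> j \<in> ?A \<Longrightarrow> i < j \<Longrightarrow> shift (s i) = shift (s j) \<Longrightarrow> p i < p j"
      using exists_fibrewise_increasing_matching[of ?A "\<lambda>i. shift (s i)" s, OF finite_atLeastAtMost] by blast
    have pA: "p i \<in> ?A" if "i \<in> ?A" for i by (simp only: permutes_in_image[OF p(1)] that)
    have it: "itinerary c p i = s i" if "i \<in> ?A" for i
    proof -
      have "(p ^^ k) i \<in> ?A \<and> s ((p ^^ k) i) = (shift ^^ k) (s i)" for k
        using that by (induction k) (auto simp: p(2) pA simp del: atLeastAtMost_iff One_nat_def)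
      then have "c ((p ^^ k) i) = s i k" for k
        using c_s[of "(p ^^ k) i"] by (simp add: funpow_shift)
      then show ?thesis by (simp add: itinerary_def)
    qed
    then have "?\<Phi> p = image_mset s (mset_set ?A)"
      by (intro image_mset_cong) auto
    then have \<Phi>p: "?\<Phi> p = M" using s(1) by simp
    have "block_mono \<epsilon> ?A c p"
      unfolding block_mono_def
    proof (intro ballI impI)
      fix i j assume ij: "i \<in> ?A" "j \<in> ?A" "i < j" "c i = c j"
      have le: "key \<epsilon> (Suc N) (s i) \<le> key \<epsilon> (Suc N) (s j)"
        using monotone_onD[OF s(2) ij(1,2)] ij(3) by simp
      have ne: "p i \<noteq> p j" using permutes_inj[OF p(1)] ij(3) by (auto dest: injD)
      show "\<epsilon> * int (p i) < \<epsilon> * int (p j)"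
      proof (cases "s i = s j")
        case True
        then have "\<not> inj_on (itinerary c p) ?A"
          using it[OF ij(1)] it[OF ij(2)] ij(1-3) inj_onD[of "itinerary c p" ?A i j] by auto
        then have "\<epsilon> = 1" using count1[of p] M \<Phi>p by auto
        then show ?thesis using True p(3) ij by simp
      next
        case False
        \<comment> \<open>\<open>shift\<close> is injective on the support, so different words stay
          different once the first letter is removed.\<close>
        then have "shift (s i) \<noteq> shift (s j)"
          using inj_onD[OF inj_on_shift[OF invM], of "s i" "s j"] sM ij(1,2) by blast
        then have ne_key: "key \<epsilon> N (s (p i)) \<noteq> key \<epsilon> N (s (p j))"
          using inj_onD[OF N, of "s (p i)" "s (p j)"] sM[OF pA] p(2)[OF ij(1)] p(2)[OF ij(2)] ij(1,2)
          by metis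
        have key_le: "key \<epsilon> N (s (p k)) \<le> key \<epsilon> N (s (p l))" if "k \<in> ?A" "l \<in> ?A" "p k < p l" for k l
        proof (rule key_le_prefix[OF \<epsilon>])
          show "key \<epsilon> (Suc N) (s (p k)) \<le> key \<epsilon> (Suc N) (s (p l))"
            using monotone_onD[OF s(2) pA[OF that(1)] pA[OF that(2)]] that(3)
            by (simp only: comp_def less_imp_le)
        qed
        \<comment> \<open>The first letters agree, so \<open>le\<close> compares the tails, the
          words at \<open>p i\<close> and \<open>p j\<close>; since words are listed in key order,
          this decides the order of \<open>p i\<close> and \<open>p j\<close>.\<close>
        have "if \<epsilon> = 1 then key \<epsilon> N (s (p i)) \<le> key \<epsilon> N (s (p j))
            else key \<epsilon> N (s (p j)) \<le> key \<epsilon> N (s (p i))"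
          using le[unfolded key_Suc_le_iff[OF \<epsilon>]] c_s[OF ij(1)] c_s[OF ij(2)] ij(4)
            p(2)[OF ij(1)] p(2)[OF ij(2)] by (simp split: if_splits)
        then have less: "if \<epsilon> = 1 then key \<epsilon> N (s (p i)) < key \<epsilon> N (s (p j))
            else key \<epsilon> N (s (p j)) < key \<epsilon> N (s (p i))"
          using ne_key by (auto simp: order_less_le split: if_splits)
        show ?thesis
        proof (cases "\<epsilon> = 1")
          case True
          then have "\<not> p j < p i" using key_le[OF ij(2,1)] less by auto
          then show ?thesis using ne True by simp
        next
          case False
          then have "\<not> p i < p j" using key_le[OF ij(1,2)] less by auto
          then show ?thesis using ne False \<epsilon> by simp
        qed
      qed
    qed
    moreover have "\<epsilon> = 1 \<or> inj_on (itinerary c p) ?A"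
      using count1[of p] M \<Phi>p by auto
    ultimately have "p \<in> ?P" using p(1) by blast
    then show "M \<in> ?\<Phi> ` ?P" using \<Phi>p by blast
  qed
qed

section \<open>Cycle lengths and periods\<close>

text \<open>The minimal period divides every period, so a periodic word has an odd period iff its
  minimal period is odd; an odd \<open>d\<close> is never zero.\<close>

definition odd_period :: "(nat \<Rightarrow> 'a) \<Rightarrow> bool" where
  "odd_period u \<longleftrightarrow> (\<exists>d. odd d \<and> (shift ^^ d) u = u)"

text \<open>The size of the orbit is the first return time, and \<open>d\<close> can be reduced
  modulo it; no smaller positive exponent returns to \<open>x\<close>.\<close>

lemma funpow_eq_self_iff:
  assumes "x \<in> orbit f x"
  shows "(f ^^ d) x = x \<longleftrightarrow> card (orbit f x) dvd d"
proof -
  let ?L = "funpow_dist1 f x x"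
  have L: "(f ^^ ?L) x = x" using assms by (rule funpow_dist1_prop)
  have card: "card (orbit f x) = ?L"
    by (simp add: orbit_conv_funpow_dist1[OF assms] card_image[OF inj_on_funpow_dist1[OF assms]]
        del: funpow.simps)
  have mod: "(f ^^ (d mod ?L)) x = (f ^^ d) x"
    using L by (rule funpow_mod_eq)
  show ?thesis
  proof
    assume "(f ^^ d) x = x"
    then have "(f ^^ (d mod ?L)) x = x" using mod by simp
    moreover have "d mod ?L < ?L" by simp
    ultimately have "d mod ?L = 0" using funpow_dist1_least by (metis gr0I)
    then show "card (orbit f x) dvd d" unfolding card by (rule mod_0_imp_dvd)
  next
    assume "card (orbit f x) dvd d"
    then have "d mod ?L = 0" unfolding card by simp
    then show "(f ^^ d) x = x" using mod by (metis funpow_0)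
  qed
qed

lemma funpow_eq_self_iff_cycle_len:
  assumes "p permutes A" "finite A"
  shows "(p ^^ d) i = i \<longleftrightarrow> cycle_len p i dvd d"
  unfolding cycle_len_def
  by (rule funpow_eq_self_iff, rule permutation_self_in_orbit)
    (use assms permutation_permutes in blast)

lemma cycle_len_pos:
  assumes "p permutes A" "finite A"
  shows "cycle_len p i > 0"
proof -
  have "i \<in> orbit p i"
    using assms permutation_permutes by (intro permutation_self_in_orbit) blast
  then show ?thesis
    unfolding cycle_len_def by (simp add: card_gt_0_iff finite_orbit orbit_nonempty)
qed

text \<open>The word of a cycle is primitive. For \<open>\<epsilon> = 1\<close>, if
  \<open>(p ^^ d) i\<close> differed from \<open>i\<close> but had the same word, the iterates of
  \<open>p ^^ d\<close> would move strictly in one direction and never return to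
  \<open>i\<close>.\<close>

lemma itinerary_period_iff:
  assumes p: "p permutes A" "finite A" and mono: "block_mono \<epsilon> A c p"
    and \<epsilon>: "\<epsilon> = 1 \<or> inj_on (itinerary c p) A" and i: "i \<in> A"
  shows "(shift ^^ d) (itinerary c p i) = itinerary c p i \<longleftrightarrow> (p ^^ d) i = i"
proof
  assume "(shift ^^ d) (itinerary c p i) = itinerary c p i"
  then have it: "itinerary c p ((p ^^ d) i) = itinerary c p i"
    by (simp add: funpow_shift_itinerary)
  have A: "(p ^^ d) i \<in> A" using i permutes_in_funpow_image[OF p(1)] by blast
  show "(p ^^ d) i = i"
  proof (cases "\<epsilon> = 1")
    case True
    let ?a = "\<lambda>k. (p ^^ (d * k)) i"
    have step: "?a (Suc k) = (p ^^ (d * k)) ((p ^^ d) i)" for k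
      by (simp add: funpow_add[symmetric] flip: comp_apply[of "p ^^ (d * k)"]) (simp add: add.commute)
    have "?a (cycle_len p i) = i"
      using funpow_eq_self_iff_cycle_len[OF p] by simp
    then have loop: "?a (cycle_len p i) = ?a 0" by simp
    have pos: "cycle_len p i > 0" using cycle_len_pos[OF p] .
    show ?thesis
    proof (rule ccontr)
      assume "(p ^^ d) i \<noteq> i"
      then consider "i < (p ^^ d) i" | "(p ^^ d) i < i" by linarith
      then show False
      proof cases
        case 1
        then have "?a k < ?a (Suc k)" for k
          using block_mono_funpow[OF p(1) mono i A 1 it[symmetric], of "d * k"] step[of k] True by simp
        then have "?a 0 < ?a (cycle_len p i)" by (rule lift_Suc_mono_less) (rule pos)
        then show False using loop by simp
      next
        case 2
        then have "?a (Suc k) < ?a k" for k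
          using block_mono_funpow[OF p(1) mono A i 2 it, of "d * k"] step[of k] True by simp
        then have "- int (?a k) < - int (?a (Suc k))" for k by simp
        then have "- int (?a 0) < - int (?a (cycle_len p i))"
          by (rule lift_Suc_mono_less[where f = "\<lambda>k. - int (?a k)"]) (rule pos)
        then show False using loop by simp
      qed
    qed
  next
    case False
    then show ?thesis using \<epsilon> it A i by (auto dest: inj_onD)
  qed
qed (simp add: funpow_shift_itinerary)

lemma odd_period_itinerary_iff:
  assumes "p permutes A" "finite A" "block_mono \<epsilon> A c p"
    and "\<epsilon> = 1 \<or> inj_on (itinerary c p) A" "i \<in> A"
  shows "odd_period (itinerary c p i) \<longleftrightarrow> odd (cycle_len p i)"
  unfolding odd_period_def itinerary_period_iff[OF assms] funpow_eq_self_iff_cycle_len[OF assms(1,2)]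
proof
  assume "odd (cycle_len p i)"
  then show "\<exists>d. odd d \<and> cycle_len p i dvd d" by (intro exI[of _ "cycle_len p i"]) simp
qed (use dvd_trans[of 2 "cycle_len p i"] in blast)

text \<open>If \<open>i < j\<close> had the same word, the product of their cycle lengths would be
  an odd number of steps that fixes both points and yet reverses their order.\<close>

lemma inj_on_itinerary_of_odd_cycles:
  assumes p: "p permutes A" "block_mono (-1) A c p" and A: "finite A"
    and odd: "\<And>i. i \<in> A \<Longrightarrow> odd (cycle_len p i)"
  shows "inj_on (itinerary c p) A"
proof -
  have "\<not> i < j" if ij: "i \<in> A" "j \<in> A" "itinerary c p i = itinerary c p j" for i j
  proof
    assume less: "i < j"
    let ?K = "cycle_len p i * cycle_len p j"
    have "odd ?K" using odd ij by simp
    moreover have "(p ^^ ?K) i = i" "(p ^^ ?K) j = j"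
      using funpow_eq_self_iff_cycle_len[OF p(1) A] by simp_all
    ultimately show False
      using block_mono_funpow[OF p ij(1,2) less ij(3), of ?K] less by simp
  qed
  then show ?thesis by (intro inj_onI) (metis linorder_less_linear)
qed

section \<open>Counting permutations by shift-invariant multisets\<close>

definition odd_multisets :: "'a multiset \<Rightarrow> (nat \<Rightarrow> 'a) multiset set" where
  "odd_multisets \<gamma> = {M \<in> shift_multisets \<gamma>. \<forall>u\<in>#M. odd_period u}"

definition even_multisets :: "'a multiset \<Rightarrow> (nat \<Rightarrow> 'a) multiset set" where
  "even_multisets \<gamma> = {M \<in> shift_multisets \<gamma>. \<forall>u\<in>#M. \<not> odd_period u}"

text \<open>Multiplicity at most one means that no necklace is repeated: these encode sets of odd
  primitive necklaces.\<close>

definition odd_sets :: "'a multiset \<Rightarrow> (nat \<Rightarrow> 'a) multiset set" where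
  "odd_sets \<gamma> = {M \<in> odd_multisets \<gamma>. \<forall>u. count M u \<le> 1}"

lemma bij_betw_restrict:
  assumes "bij_betw f P Q" "\<And>x. x \<in> P \<Longrightarrow> A x \<longleftrightarrow> B (f x)"
  shows "bij_betw f {x \<in> P. A x} {y \<in> Q. B y}"
  using assms by (auto simp: bij_betw_def inj_on_def)

text \<open>Both sides count the permutations increasing on blocks: through their itineraries, and
  through the words \<open>c (inv p j)\<close>, of which \<open>inv p\<close> is the
  standardization.\<close>

lemma card_shift_multisets_eq_permutations:
  fixes \<gamma> :: "nat multiset"
  shows "finite (shift_multisets \<gamma>)"
    and "card (shift_multisets \<gamma>) = card (permutations_of_multiset \<gamma>)"
proof -
  define n where "n = size \<gamma>"
  let ?A = "{1..n}"
  obtain c where c: "mono_on ?A c" "image_mset c (mset_set ?A) = \<gamma>"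
    using exists_mono_on_enumeration[of \<gamma> "\<lambda>x. x"] unfolding n_def comp_def by metis
  let ?P = "{p. p permutes ?A \<and> block_mono 1 ?A c p}"
  have bij: "bij_betw (\<lambda>p. image_mset (itinerary c p) (mset_set ?A)) ?P (shift_multisets \<gamma>)"
    using bij_betw_itineraries[of 1, OF _ c] by simp
  have "finite ?P" using finite_permutations[of ?A] by (rule rev_finite_subset) auto
  then show "finite (shift_multisets \<gamma>)"
    using bij_betw_finite[OF bij] by blast
  let ?\<Psi> = "\<lambda>p. map (\<lambda>j. c (inv p j)) [1..<Suc n]"
  have mset_A: "mset [1..<Suc n] = mset_set ?A"
    by (simp only: mset_upt atLeastLessThanSuc_atLeastAtMost)
  have "bij_betw ?\<Psi> ?P (permutations_of_multiset \<gamma>)"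
  proof (rule bij_betw_imageI)
    show "inj_on ?\<Psi> ?P"
    proof (rule inj_onI)
      fix p q assume p: "p \<in> ?P" and q: "q \<in> ?P" and eq: "?\<Psi> p = ?\<Psi> q"
      have "c (inv p j) = c (inv q j)" if "j \<in> ?A" for j
        using eq that by (simp only: map_eq_conv set_upt atLeastLessThanSuc_atLeastAtMost)
      \<comment> \<open>Both \<open>p\<close> and \<open>q\<close> match \<open>c\<close> with the
        common word, increasingly on blocks, so uniqueness of the matching applies.\<close>
      then have q': "c (inv p (q i)) = c i" if "i \<in> ?A" for i
        using that q permutes_in_image[of q ?A i] permutes_inverses(2)[of q ?A i] by simp
      have p': "c (inv p (p i)) = c i" for i
        using p permutes_inverses(2)[of p ?A i] by simp
      show "p = q"
        using p q p' q'
        by (intro fibrewise_increasing_matching_unique[of p ?A "c \<circ> inv p" c q])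
          (simp_all add: block_mono_def del: atLeastAtMost_iff)
    qed
    show "?\<Psi> ` ?P = permutations_of_multiset \<gamma>"
    proof (intro antisym subsetI)
      fix w assume "w \<in> ?\<Psi> ` ?P"
      then obtain p where p: "p permutes ?A" "w = ?\<Psi> p" by blast
      have "mset w = image_mset c (image_mset (inv p) (mset_set ?A))"
        by (simp only: p(2) mset_map mset_A image_mset.compositionality comp_def)
      also have "image_mset (inv p) (mset_set ?A) = mset_set ?A"
        using permutes_inv[OF p(1)]
        by (subst image_mset_mset_set) (auto simp: permutes_image permutes_inj_on)
      finally show "w \<in> permutations_of_multiset \<gamma>"
        using c(2) by (simp add: permutations_of_multiset_def)
    next
      fix w assume "w \<in> permutations_of_multiset \<gamma>"
      then have w: "mset w = \<gamma>" "length w = n"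
        by (auto simp: permutations_of_multiset_def n_def)
      let ?g = "\<lambda>i. w ! (i - 1)"
      have map_g: "map ?g [1..<Suc n] = w"
        unfolding One_nat_def map_Suc_upt[symmetric] map_map comp_def w(2)[symmetric] diff_Suc_Suc diff_zero
        by (rule map_nth)
      then have "image_mset ?g (mset_set ?A) = \<gamma>"
        using w(1) by (metis mset_A mset_map)
      then obtain p where p: "p permutes ?A" "\<And>i. i \<in> ?A \<Longrightarrow> ?g (p i) = c i"
          "\<And>i j. i \<in> ?A \<Longrightarrow> j \<in> ?A \<Longrightarrow> i < j \<Longrightarrow> c i = c j \<Longrightarrow> p i < p j"
        using exists_fibrewise_increasing_matching[of ?A c ?g] c(2) by auto
      have g: "?g j = c (inv p j)" if "j \<in> ?A" for j
        using p(2)[of "inv p j"] that permutes_in_image[OF permutes_inv[OF p(1)]]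
          permutes_inverses(1)[OF p(1)] by metis
      have "?\<Psi> p = map ?g [1..<Suc n]"
        unfolding map_eq_conv set_upt atLeastLessThanSuc_atLeastAtMost by (blast intro: g[symmetric])
      then have "w = ?\<Psi> p" unfolding map_g by (rule sym)
      moreover have "p \<in> ?P" using p by (auto simp: block_mono_def)
      ultimately show "w \<in> ?\<Psi> ` ?P" by blast
    qed
  qed
  from bij_betw_same_card[OF this] bij_betw_same_card[OF bij]
  show "card (shift_multisets \<gamma>) = card (permutations_of_multiset \<gamma>)"
    by (simp only:)
qed

section \<open>Blocks cut out by a subset, with descents and ascents inside them\<close>

text \<open>The index of the block of \<open>i\<close> when cuts are made after the elements of
  \<open>S\<close>; the strict inequality keeps an element of \<open>S\<close> in the block that it
  ends.\<close>

definition block :: "nat set \<Rightarrow> nat \<Rightarrow> nat" where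
  "block S i = card {j \<in> S. j < i}"

lemma mono_on_block: "finite S \<Longrightarrow> mono_on A (block S)"
  unfolding block_def by (intro mono_onI card_mono) auto

text \<open>Two positions share a block iff no cut separates them, and along a block the
  inequalities between neighbours chain together.\<close>

lemma block_mono_block_iff:
  assumes "finite S"
  shows "block_mono \<epsilon> {1..n} (block S) p \<longleftrightarrow>
    (\<forall>i\<in>{1..n-1} - S. \<epsilon> * int (p i) < \<epsilon> * int (p (Suc i)))"
proof
  assume mono: "block_mono \<epsilon> {1..n} (block S) p"
  show "\<forall>i\<in>{1..n-1} - S. \<epsilon> * int (p i) < \<epsilon> * int (p (Suc i))"
  proof
    fix i assume i: "i \<in> {1..n-1} - S"
    then have "{j \<in> S. j < i} = {j \<in> S. j < Suc i}" by (auto simp: less_Suc_eq)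
    then have "block S i = block S (Suc i)" by (simp add: block_def)
    moreover have "i \<in> {1..n}" "Suc i \<in> {1..n}" using i by auto
    ultimately show "\<epsilon> * int (p i) < \<epsilon> * int (p (Suc i))"
      using mono by (simp add: block_mono_def)
  qed
next
  assume step: "\<forall>i\<in>{1..n-1} - S. \<epsilon> * int (p i) < \<epsilon> * int (p (Suc i))"
  show "block_mono \<epsilon> {1..n} (block S) p"
    unfolding block_mono_def
  proof (intro ballI impI)
    fix i j assume ij: "i \<in> {1..n}" "j \<in> {1..n}" "i < j" "block S i = block S j"
    \<comment> \<open>One set contains the other and the cardinalities agree, so no \<open>k\<close>
      with \<open>i \<le> k\<close> and \<open>k < j\<close> is a cut.\<close>
    have eq: "{k \<in> S. k < i} = {k \<in> S. k < j}"
      using ij assms unfolding block_def by (intro card_subset_eq) auto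
    have notin: "k \<notin> S" if "i \<le> k" "k < j" for k
    proof
      assume "k \<in> S"
      then have "k \<in> {k \<in> S. k < i}" unfolding eq using that by simp
      then show False using that by simp
    qed
    have "Suc i \<le> j" using ij by simp
    then have "j \<le> n \<Longrightarrow> (\<And>k. i \<le> k \<Longrightarrow> k < j \<Longrightarrow> k \<notin> S) \<Longrightarrow> \<epsilon> * int (p i) < \<epsilon> * int (p j)"
    proof (induction j rule: dec_induct)
      case base
      have "i \<in> {1..n-1} - S" using base ij by auto
      then show ?case using step by blast
    next
      case (step m)
      have "m \<in> {1..n-1} - S" using step ij by auto
      then have "\<epsilon> * int (p m) < \<epsilon> * int (p (Suc m))"
        using \<open>\<forall>i\<in>{1..n-1} - S. \<epsilon> * int (p i) < \<epsilon> * int (p (Suc i))\<close> by blast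
      moreover have "\<epsilon> * int (p i) < \<epsilon> * int (p m)" using step by simp
      ultimately show ?case by simp
    qed
    then show "\<epsilon> * int (p i) < \<epsilon> * int (p j)" using ij notin by auto
  qed
qed

lemma Des_subset_iff:
  assumes "p permutes {1..n}" "finite S"
  shows "Des n p \<subseteq> S \<longleftrightarrow> block_mono 1 {1..n} (block S) p"
proof -
  have ne: "p i \<noteq> p (Suc i)" for i by (simp add: inj_eq[OF permutes_inj[OF assms(1)]])
  have "p i < p (Suc i) \<longleftrightarrow> \<not> p (Suc i) < p i" for i using ne[of i] by arith
  then have "Des n p \<subseteq> S \<longleftrightarrow> (\<forall>i\<in>{1..n-1} - S. p i < p (Suc i))"
    unfolding Des_def by blast
  then show ?thesis
    unfolding block_mono_block_iff[OF assms(2)] by simp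
qed

lemma Asc_subset_iff:
  assumes "p permutes {1..n}" "finite S"
  shows "Asc n p \<subseteq> S \<longleftrightarrow> block_mono (-1) {1..n} (block S) p"
proof -
  have ne: "p i \<noteq> p (Suc i)" for i by (simp add: inj_eq[OF permutes_inj[OF assms(1)]])
  have "p (Suc i) < p i \<longleftrightarrow> \<not> p i < p (Suc i)" for i using ne[of i] by arith
  then have "Asc n p \<subseteq> S \<longleftrightarrow> (\<forall>i\<in>{1..n-1} - S. p (Suc i) < p i)"
    unfolding Asc_def by blast
  then show ?thesis
    unfolding block_mono_block_iff[OF assms(2)] by simp
qed

section \<open>From the two sets of permutations to invariant multisets\<close>

text \<open>Odd cycles force distinct itineraries, so the injectivity condition in the
  correspondence for \<open>\<epsilon> = -1\<close> holds automatically; odd cycle lengths become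
  odd periods.\<close>

lemma card_odd_perms:
  assumes "finite S" and \<gamma>: "\<gamma> = image_mset (block S) (mset_set {1..n})"
  shows "card {p \<in> odd_perms n. Asc n p \<subseteq> S} = card (odd_sets \<gamma>)"
proof -
  let ?c = "block S" and ?A = "{1..n}"
  let ?P = "{p. p permutes ?A \<and> block_mono (-1) ?A ?c p \<and> inj_on (itinerary ?c p) ?A}"
  let ?Q = "{M \<in> shift_multisets \<gamma>. \<forall>u. count M u \<le> 1}"
  have "bij_betw (\<lambda>p. image_mset (itinerary ?c p) (mset_set ?A)) ?P ?Q"
    using bij_betw_itineraries[of "-1" n ?c \<gamma>] mono_on_block[OF assms(1)] \<gamma> by simp
  then have "bij_betw (\<lambda>p. image_mset (itinerary ?c p) (mset_set ?A))
      {p \<in> ?P. \<forall>i\<in>?A. odd (cycle_len p i)} {M \<in> ?Q. \<forall>u\<in>#M. odd_period u}"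
    by (rule bij_betw_restrict) (auto simp: odd_period_itinerary_iff[where A = ?A and \<epsilon> = "-1"])
  moreover have "{M \<in> ?Q. \<forall>u\<in>#M. odd_period u} = odd_sets \<gamma>"
    by (auto simp: odd_sets_def odd_multisets_def)
  moreover have "{p \<in> ?P. \<forall>i\<in>?A. odd (cycle_len p i)} = {p \<in> odd_perms n. Asc n p \<subseteq> S}"
  proof (intro set_eqI iffI)
    fix p assume "p \<in> {p \<in> ?P. \<forall>i\<in>?A. odd (cycle_len p i)}"
    then show "p \<in> {p \<in> odd_perms n. Asc n p \<subseteq> S}"
      using Asc_subset_iff[OF _ assms(1)] by (simp add: odd_perms_def perms_def)
  next
    fix p assume "p \<in> {p \<in> odd_perms n. Asc n p \<subseteq> S}"
    then have p: "p permutes ?A" "\<forall>i\<in>?A. odd (cycle_len p i)" "Asc n p \<subseteq> S"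
      by (simp_all add: odd_perms_def perms_def)
    then have mono: "block_mono (-1) ?A ?c p"
      using Asc_subset_iff[OF _ assms(1)] by blast
    with p have "inj_on (itinerary ?c p) ?A"
      by (intro inj_on_itinerary_of_odd_cycles) auto
    with p mono show "p \<in> {p \<in> ?P. \<forall>i\<in>?A. odd (cycle_len p i)}" by simp
  qed
  ultimately show ?thesis by (simp only: bij_betw_same_card)
qed

text \<open>In the correspondence for \<open>\<epsilon> = 1\<close>, points on odd cycles give words
  of odd period and fixed points give constant words, so the odd part is empty or a single constant
  word.\<close>

lemma card_even_perms:
  assumes "finite S" and \<gamma>: "\<gamma> = image_mset (block S) (mset_set {1..n})"
  shows "card {p \<in> even_perms n. Des n p \<subseteq> S} =
    card {M \<in> shift_multisets \<gamma>. filter_mset odd_period M = {#} \<or>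
      (\<exists>a. filter_mset odd_period M = {#\<lambda>_. a#})}"
proof -
  let ?c = "block S" and ?A = "{1..n}"
  let ?P = "{p. p permutes ?A \<and> block_mono 1 ?A ?c p}"
  let ?B = "\<lambda>M. filter_mset odd_period M = {#} \<or> (\<exists>a. filter_mset odd_period M = {#\<lambda>_. a#})"
  let ?E = "\<lambda>p. (\<forall>x\<in>?A. even (cycle_len p x) \<or> cycle_len p x = 1) \<and>
      card {x\<in>?A. cycle_len p x = 1} \<le> 1"
  let ?\<Phi> = "\<lambda>p. image_mset (itinerary ?c p) (mset_set ?A)"
  have "bij_betw ?\<Phi> ?P (shift_multisets \<gamma>)"
    using bij_betw_itineraries[of "1" n ?c \<gamma>] mono_on_block[OF assms(1)] \<gamma> by simp
  moreover have "?E p \<longleftrightarrow> ?B (?\<Phi> p)" if p: "p \<in> ?P" for p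
  proof -
    let ?O = "{i \<in> ?A. odd (cycle_len p i)}"
    have "{i \<in> ?A. odd_period (itinerary ?c p i)} = ?O"
      using odd_period_itinerary_iff[of p ?A 1 ?c] p by auto
    then have filter: "filter_mset odd_period (?\<Phi> p) = image_mset (itinerary ?c p) (mset_set ?O)"
      by (simp add: filter_mset_image_mset)
    have len1: "cycle_len p i = 1 \<longleftrightarrow> shift (itinerary ?c p i) = itinerary ?c p i" if "i \<in> ?A" for i
      using itinerary_period_iff[of p ?A 1 ?c i 1] funpow_eq_self_iff_cycle_len[of p ?A 1 i] p that
      by simp
    have const: "u = (\<lambda>_. u 0)" if "shift u = u" for u :: "nat \<Rightarrow> nat"
    proof
      fix k show "u k = u 0"
        using fun_cong[OF that] by (induction k) (simp_all add: shift_def)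
    qed
    show ?thesis
    proof
      assume E: "?E p"
      then have O: "?O = {i \<in> ?A. cycle_len p i = 1}" by auto
      show "?B (?\<Phi> p)"
      proof (cases "?O = {}")
        case False
        then have "card ?O > 0" by (simp add: card_gt_0_iff)
        moreover have "card ?O \<le> 1" using E unfolding O by blast
        ultimately have "card ?O = 1" by linarith
        then obtain x where x: "?O = {x}" by (rule card_1_singletonE)
        then have "cycle_len p x = 1" "x \<in> ?A" using O by auto
        then have "itinerary ?c p x = (\<lambda>_. itinerary ?c p x 0)"
          using const len1 by blast
        then show ?thesis unfolding filter x by auto
      next
        case True
        then show ?thesis unfolding filter True by simp
      qed
    next
      assume B: "?B (?\<Phi> p)"
      then consider "?O = {}" | a where "image_mset (itinerary ?c p) (mset_set ?O) = {#\<lambda>_. a#}"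
        unfolding filter by (auto simp: mset_set_empty_iff)
      then show "?E p"
      proof cases
        case 1
        then have empty: "{x\<in>?A. cycle_len p x = 1} = {}" by auto
        have "card {x\<in>?A. cycle_len p x = 1} \<le> 1" unfolding empty by simp
        with 1 show ?thesis by blast
      next
        case 2
        have "card ?O = 1"
          using arg_cong[OF 2, of size] by (simp only: size_image_mset size_mset_set size_single)
        then obtain x where x: "?O = {x}" by (rule card_1_singletonE)
        \<comment> \<open>The only point on an odd cycle has a constant word, hence is fixed, and
          all other cycles are even.\<close>
        then have "itinerary ?c p x = (\<lambda>_. a)" using 2 by simp
        then have "shift (itinerary ?c p x) = itinerary ?c p x" by (simp add: shift_def)
        moreover have "x \<in> ?A" using x by auto
        ultimately have one: "cycle_len p x = 1" using len1 by blast
        have odd: "y = x" if "y \<in> ?A" "odd (cycle_len p y)" for y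
        proof -
          have "y \<in> ?O" using that by blast
          then show ?thesis unfolding x by blast
        qed
        then have even_or_one: "\<forall>y\<in>?A. even (cycle_len p y) \<or> cycle_len p y = 1"
          using one by metis
        have "{y\<in>?A. cycle_len p y = 1} \<subseteq> {x}"
          using odd odd_one by fastforce
        then have "card {y\<in>?A. cycle_len p y = 1} \<le> card {x}"
          by (intro card_mono) simp_all
        with even_or_one show ?thesis by simp
      qed
    qed
  qed
  ultimately have "bij_betw ?\<Phi> {p \<in> ?P. ?E p} {M \<in> shift_multisets \<gamma>. ?B M}"
    by (rule bij_betw_restrict)
  moreover have "{p \<in> ?P. ?E p} = {p \<in> even_perms n. Des n p \<subseteq> S}"
    using Des_subset_iff[OF _ assms(1)] by (auto simp: even_perms_def perms_def)
  ultimately show ?thesis by (simp only: bij_betw_same_card)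
qed

section \<open>Orbits in shift-invariant multisets\<close>

text \<open>\<open>orbit\<close> starts at \<open>shift u\<close>, so membership of \<open>u\<close>
  itself expresses periodicity; it holds because \<open>shift\<close> permutes the finite
  support.\<close>

lemma self_in_orbit_shift:
  assumes M: "image_mset shift M = M" and u: "u \<in># M"
  shows "u \<in> orbit shift u" and "orbit shift u \<subseteq> set_mset M"
proof -
  have im: "shift ` set_mset M = set_mset M"
    using arg_cong[OF M, of set_mset] by simp
  show "orbit shift u \<subseteq> set_mset M"
  proof
    fix v assume "v \<in> orbit shift u"
    then show "v \<in># M"
      by induction (use im u in blast)+
  qed
  \<comment> \<open>The identity off the support turns \<open>shift\<close> into a permutation with
    the same orbit of \<open>u\<close>.\<close>
  let ?f = "\<lambda>v. if v \<in># M then shift v else v"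
  have "bij_betw shift (set_mset M) (set_mset M)"
    using im inj_on_shift[OF M] by (simp add: bij_betw_def)
  then have "bij_betw ?f (set_mset M) (set_mset M)"
    by (rule bij_betw_cong[THEN iffD1, rotated]) simp
  then have "?f permutes set_mset M"
    by (rule bij_imp_permutes) simp
  then have "u \<in> orbit ?f u"
    by (intro permutation_self_in_orbit) (meson finite_set_mset permutation_permutes)
  moreover have "orbit ?f u = orbit shift u"
    by (rule orbit_cong0[of u "set_mset M"]) (use u im in auto)
  ultimately show "u \<in> orbit shift u" by simp
qed

lemma orbit_eq_of_mem:
  assumes "u \<in> orbit f u" "v \<in> orbit f u"
  shows "orbit f v = orbit f u"
  using assms by (metis cyclic_on_singleI orbit_cyclic_eq3)

lemma odd_period_iff_card_orbit:
  assumes "u \<in> orbit shift u"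
  shows "odd_period u \<longleftrightarrow> odd (card (orbit shift u))"
  unfolding odd_period_def funpow_eq_self_iff[OF assms]
proof
  assume "odd (card (orbit shift u))"
  then show "\<exists>d. odd d \<and> card (orbit shift u) dvd d"
    by (intro exI[of _ "card (orbit shift u)"]) simp
qed (use dvd_trans[of 2 "card (orbit shift u)"] in blast)

lemma odd_period_shift:
  assumes M: "image_mset shift M = M" and u: "u \<in># M"
  shows "odd_period (shift u) \<longleftrightarrow> odd_period u"
proof -
  note self = self_in_orbit_shift(1)[OF M u]
  have mem: "shift u \<in> orbit shift u" by (rule orbit.base)
  then have "shift u \<in># M" using self_in_orbit_shift(2)[OF M u] by blast
  from odd_period_iff_card_orbit[OF self_in_orbit_shift(1)[OF M this]] orbit_eq_of_mem[OF self mem]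
  show ?thesis by (simp only: odd_period_iff_card_orbit[OF self])
qed

text \<open>One copy of each word of an orbit encodes a single necklace, which can thus be split off
  from \<open>M\<close>.\<close>

lemma shift_orbit_mset:
  assumes M: "image_mset shift M = M" and u: "u \<in># M"
  shows "image_mset shift (mset_set (orbit shift u)) = mset_set (orbit shift u)"
    and "mset_set (orbit shift u) \<subseteq># M"
proof -
  note self = self_in_orbit_shift[OF M u]
  have inj: "inj_on shift (orbit shift u)"
    using inj_on_shift[OF M] self(2) by (rule inj_on_subset)
  have "shift ` orbit shift u = orbit shift (shift u)"
    by (rule orbit_inverse[OF self(1)]) simp
  also have "\<dots> = orbit shift u" by (rule self_in_orbit_step[OF self(1)])
  finally show "image_mset shift (mset_set (orbit shift u)) = mset_set (orbit shift u)"
    by (simp add: image_mset_mset_set[OF inj])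
  have "mset_set (orbit shift u) \<subseteq># mset_set (set_mset M)"
    using self(2) by (intro subset_imp_msubset_mset_set) simp_all
  then show "mset_set (orbit shift u) \<subseteq># M"
    by (rule subset_mset.order_trans[OF _ mset_set_set_mset_msubset])
qed

lemma image_shift_diff:
  assumes "image_mset shift M = M" "image_mset shift N = N" "N \<subseteq># M"
  shows "image_mset shift (M - N) = M - N"
  using assms by (simp add: image_mset_Diff)

text \<open>Parity of the period is constant along orbits, so filtering by it commutes with
  \<open>shift\<close>.\<close>

lemma image_shift_filter:
  assumes M: "image_mset shift M = M"
  shows "image_mset shift (filter_mset odd_period M) = filter_mset odd_period M"
    and "image_mset shift (filter_mset (\<lambda>u. \<not> odd_period u) M) = filter_mset (\<lambda>u. \<not> odd_period u) M"
proof -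
  have "filter_mset odd_period M = filter_mset odd_period (image_mset shift M)"
    by (simp only: M)
  also have "\<dots> = image_mset shift (filter_mset (\<lambda>u. odd_period (shift u)) M)"
    by (rule filter_mset_image_mset)
  also have "filter_mset (\<lambda>u. odd_period (shift u)) M = filter_mset odd_period M"
    by (rule filter_mset_cong[OF refl]) (rule odd_period_shift[OF M])
  finally show 1: "image_mset shift (filter_mset odd_period M) = filter_mset odd_period M" ..
  have "filter_mset (\<lambda>u. \<not> odd_period u) M = M - filter_mset odd_period M"
    using multiset_partition[of M odd_period] by (metis add_diff_cancel_left')
  then show "image_mset shift (filter_mset (\<lambda>u. \<not> odd_period u) M) = filter_mset (\<lambda>u. \<not> odd_period u) M"
    using image_shift_diff[OF M 1 multiset_filter_subset] by simp
qed

text \<open>Orbits are removed one at a time, each of even size.\<close>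

lemma even_size_of_even_periods:
  assumes "image_mset shift M = M" "\<forall>u\<in>#M. \<not> odd_period u"
  shows "even (size M)"
  using assms
proof (induction M rule: measure_induct_rule[of size])
  case (less M)
  show ?case
  proof (cases "M = {#}")
    case False
    then obtain u where u: "u \<in># M" by blast
    let ?C = "orbit shift u"
    note C = shift_orbit_mset[OF less.prems(1) u]
    note self = self_in_orbit_shift(1)[OF less.prems(1) u]
    have even: "even (card ?C)"
      using odd_period_iff_card_orbit[OF self] less.prems(2) u by blast
    have "card ?C > 0"
      using finite_orbit[OF self] self by (auto simp: card_gt_0_iff)
    moreover have size: "size M = size (M - mset_set ?C) + card ?C"
      using subset_mset.diff_add[OF C(2)] by (metis size_mset_set size_union)
    ultimately have "even (size (M - mset_set ?C))"
    proof (intro less.IH)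
      show "image_mset shift (M - mset_set ?C) = M - mset_set ?C"
        by (rule image_shift_diff[OF less.prems(1) C])
      show "\<forall>v\<in>#M - mset_set ?C. \<not> odd_period v"
        using less.prems(2) in_diffD by fast
    qed simp
    then show ?thesis using even size by simp
  qed simp
qed

section \<open>Convolution identities\<close>

abbreviation content :: "(nat \<Rightarrow> 'a) multiset \<Rightarrow> 'a multiset" where
  "content M \<equiv> image_mset (\<lambda>u. u 0) M"

lemma finite_submultisets: "finite {\<alpha>. \<alpha> \<subseteq># \<gamma>}"
proof (induction \<gamma>)
  case (add x \<gamma>)
  have "{\<alpha>. \<alpha> \<subseteq># add_mset x \<gamma>} \<subseteq> {\<alpha>. \<alpha> \<subseteq># \<gamma>} \<union> add_mset x ` {\<alpha>. \<alpha> \<subseteq># \<gamma>}"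
  proof
    fix \<alpha> assume \<alpha>: "\<alpha> \<in> {\<alpha>. \<alpha> \<subseteq># add_mset x \<gamma>}"
    show "\<alpha> \<in> {\<alpha>. \<alpha> \<subseteq># \<gamma>} \<union> add_mset x ` {\<alpha>. \<alpha> \<subseteq># \<gamma>}"
    proof (cases "x \<in># \<alpha>")
      case True
      then obtain \<beta> where \<beta>: "\<alpha> = add_mset x \<beta>" by (blast dest: multi_member_split)
      then show ?thesis using \<alpha> by simp
    next
      case False
      then have "\<alpha> - {#x#} = \<alpha>" by (rule diff_single_trivial)
      then have "\<alpha> \<subseteq># \<gamma>"
        using \<alpha> by (metis mem_Collect_eq add_mset_add_single subset_eq_diff_conv)
      then show ?thesis by simp
    qed
  qed
  then show ?case using add by (blast intro: finite_subset)
qed simp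

lemma finite_odd_even_multisets:
  fixes \<gamma> :: "nat multiset"
  shows "finite (odd_multisets \<gamma>)" "finite (even_multisets \<gamma>)" "finite (odd_sets \<gamma>)"
  using card_shift_multisets_eq_permutations(1)[of \<gamma>]
  by (simp_all add: odd_multisets_def even_multisets_def odd_sets_def)

lemma size_of_mem_shift_multisets: "M \<in> shift_multisets \<gamma> \<Longrightarrow> size M = size \<gamma>"
  by (auto simp: shift_multisets_def)

text \<open>Words of content \<gamma> satisfy this recursion on removing the first letter, and they
  are equinumerous with the invariant multisets.\<close>

lemma card_shift_multisets_rec:
  fixes \<gamma> :: "nat multiset"
  assumes "\<gamma> \<noteq> {#}"
  shows "card (shift_multisets \<gamma>) = (\<Sum>a\<in>set_mset \<gamma>. card (shift_multisets (\<gamma> - {#a#})))"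
proof -
  have "card (permutations_of_multiset \<gamma>) =
      (\<Sum>a\<in>set_mset \<gamma>. card ((#) a ` permutations_of_multiset (\<gamma> - {#a#})))"
    unfolding permutations_of_multiset_nonempty[OF assms]
    by (rule card_UN_disjoint) auto
  also have "\<dots> = (\<Sum>a\<in>set_mset \<gamma>. card (permutations_of_multiset (\<gamma> - {#a#})))"
    by (intro sum.cong refl card_image) simp
  finally show ?thesis
    by (simp only: card_shift_multisets_eq_permutations(2))
qed

text \<open>An invariant multiset splits uniquely into its even and odd parts: the product over
  necklaces is factored by parity.\<close>

lemma card_shift_multisets_convolution:
  fixes \<gamma> :: "nat multiset"
  shows "card (shift_multisets \<gamma>) =
    (\<Sum>\<alpha> | \<alpha> \<subseteq># \<gamma>. card (even_multisets \<alpha>) * card (odd_multisets (\<gamma> - \<alpha>)))"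
proof -
  let ?P = "SIGMA \<alpha> : {\<alpha>. \<alpha> \<subseteq># \<gamma>}. even_multisets \<alpha> \<times> odd_multisets (\<gamma> - \<alpha>)"
  let ?ev = "\<lambda>M. filter_mset (\<lambda>u. \<not> odd_period u) M" and ?od = "\<lambda>M. filter_mset odd_period M"
  have "bij_betw (\<lambda>(\<alpha>, E, Q). E + Q) ?P (shift_multisets \<gamma>)"
  proof (rule bij_betwI[where g = "\<lambda>M. (content (?ev M), ?ev M, ?od M)"])
    show "(\<lambda>(\<alpha>, E, Q). E + Q) \<in> ?P \<rightarrow> shift_multisets \<gamma>"
      by (auto simp: shift_multisets_def even_multisets_def odd_multisets_def)
    show "(\<lambda>M. (content (?ev M), ?ev M, ?od M)) \<in> shift_multisets \<gamma> \<rightarrow> ?P"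
    proof
      fix M :: "(nat \<Rightarrow> nat) multiset" assume "M \<in> shift_multisets \<gamma>"
      then have M: "image_mset shift M = M" "content M = \<gamma>" by (auto simp: shift_multisets_def)
      have "M = ?ev M + ?od M"
        using multiset_partition[of M odd_period] by (simp only: add.commute)
      then have "\<gamma> = content (?ev M) + content (?od M)"
        using M(2) image_mset_union by metis
      then show "(content (?ev M), ?ev M, ?od M) \<in> ?P"
        using image_shift_filter[OF M(1)]
        by (simp add: shift_multisets_def even_multisets_def odd_multisets_def)
    qed
  next
    fix x assume "x \<in> ?P"
    then obtain \<alpha> E Q where x: "x = (\<alpha>, E, Q)" "E \<in> even_multisets \<alpha>" "Q \<in> odd_multisets (\<gamma> - \<alpha>)"
      by blast
    then have "?ev E = E" "?od E = {#}" "?ev Q = {#}" "?od Q = Q" "content E = \<alpha>"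
      by (auto simp: even_multisets_def odd_multisets_def shift_multisets_def
          filter_mset_eq_conv)
    then show "(\<lambda>M. (content (?ev M), ?ev M, ?od M)) ((\<lambda>(\<alpha>, E, Q). E + Q) x) = x"
      by (simp add: x(1))
  next
    fix M :: "(nat \<Rightarrow> nat) multiset"
    show "(\<lambda>(\<alpha>, E, Q). E + Q) (content (?ev M), ?ev M, ?od M) = M"
      using multiset_partition[of M odd_period] by (simp add: add.commute)
  qed
  from bij_betw_same_card[OF this]
  have "card (shift_multisets \<gamma>) = card ?P" by simp
  also have "\<dots> = (\<Sum>\<alpha> | \<alpha> \<subseteq># \<gamma>. card (even_multisets \<alpha> \<times> odd_multisets (\<gamma> - \<alpha>)))"
    by (rule card_SigmaI) (use finite_submultisets finite_odd_even_multisets in auto)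
  finally show ?thesis by (simp only: card_cartesian_product)
qed

section \<open>Cancelling odd necklaces by a sign-reversing involution\<close>

lemma sum_sign_reversing_involution:
  fixes f :: "'a \<Rightarrow> int"
  assumes "\<And>x. x \<in> P \<Longrightarrow> \<tau> x \<in> P \<and> \<tau> (\<tau> x) = x \<and> f (\<tau> x) = - f x"
  shows "sum f P = 0"
proof -
  have "(\<Sum>x\<in>P. - f x) = sum f P"
    by (rule sum.reindex_bij_witness[of P \<tau> \<tau>]) (use assms in auto)
  then show ?thesis by (simp add: sum_negf)
qed

text \<open>Moving one orbit, chosen in terms of \<open>D + Q\<close> only, between \<open>D\<close> and \<open>Q\<close> is an involution; since
  the orbit has odd size, it reverses the sign \<open>(-1) ^ size Q\<close>.\<close>

definition some_orbit :: "(nat \<Rightarrow> 'a) multiset \<Rightarrow> (nat \<Rightarrow> 'a) multiset" where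
  "some_orbit T = mset_set (orbit shift (SOME u. u \<in># T))"

definition toggle :: "'a multiset \<times> (nat \<Rightarrow> 'a) multiset \<times> (nat \<Rightarrow> 'a) multiset \<Rightarrow>
    'a multiset \<times> (nat \<Rightarrow> 'a) multiset \<times> (nat \<Rightarrow> 'a) multiset" where
  "toggle = (\<lambda>(\<alpha>, D, Q). let C = some_orbit (D + Q) in
     if C \<subseteq># D then (content (D - C), D - C, Q + C) else (content (D + C), D + C, Q - C))"

text \<open>The orbit of the chosen word lies in \<open>D\<close> if the word does; as
  \<open>D\<close> has no repetitions, removing it leaves no copy. Otherwise the orbit is disjoint
  from \<open>D\<close> and lies in \<open>Q\<close>, so adding it to \<open>D\<close> creates no
  repetition.\<close>

lemma some_orbit_props:
  assumes "D \<in> odd_sets \<alpha>" "Q \<in> odd_multisets \<beta>" "D + Q \<noteq> {#}"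
  defines "C \<equiv> some_orbit (D + Q)"
  shows "image_mset shift C = C" and "odd (size C)" and "\<forall>u\<in>#C. odd_period u"
    and "C \<subseteq># D \<Longrightarrow> \<not> C \<subseteq># D - C"
    and "\<not> C \<subseteq># D \<Longrightarrow> C \<subseteq># Q" and "\<not> C \<subseteq># D \<Longrightarrow> \<forall>u. count (D + C) u \<le> 1"
proof -
  define u where "u = (SOME u. u \<in># D + Q)"
  have u: "u \<in># D + Q"
    unfolding u_def using assms(3) by (metis multiset_nonemptyE someI)
  have C: "C = mset_set (orbit shift u)" by (simp add: C_def some_orbit_def u_def)
  have D: "image_mset shift D = D" "\<forall>u\<in>#D. odd_period u" "\<forall>u. count D u \<le> 1"
    and Q: "image_mset shift Q = Q" "\<forall>u\<in>#Q. odd_period u"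
    using assms(1,2) by (auto simp: odd_sets_def odd_multisets_def shift_multisets_def)
  have T: "image_mset shift (D + Q) = D + Q" using D Q by simp
  note self = self_in_orbit_shift[OF T u]
  have fin: "finite (orbit shift u)" by (rule finite_orbit[OF self(1)])
  show "image_mset shift C = C" unfolding C by (rule shift_orbit_mset(1)[OF T u])
  show odd: "\<forall>u\<in>#C. odd_period u"
    using self(2) D(2) Q(2) fin unfolding C by auto
  show "odd (size C)"
    unfolding C size_mset_set
    using odd_period_iff_card_orbit[OF self(1)] odd self(1) fin unfolding C by simp
  have countC: "count C v \<le> 1" for v unfolding C by (simp add: count_mset_set')
  have count_u: "count C u = 1" unfolding C using self(1) fin by simp
  show "\<not> C \<subseteq># D - C" if "C \<subseteq># D"
  proof
    assume "C \<subseteq># D - C"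
    then have "count C u \<le> count (D - C) u" by (rule mset_subset_eq_count)
    then show False using D(3)[rule_format, of u] count_u by simp
  qed
  show "C \<subseteq># Q" if "\<not> C \<subseteq># D"
  proof -
    have "u \<notin># D" using shift_orbit_mset(2)[OF D(1), of u] that unfolding C by blast
    then have "u \<in># Q" using u by simp
    then show ?thesis unfolding C by (rule shift_orbit_mset(2)[OF Q(1)])
  qed
  show "\<forall>u. count (D + C) u \<le> 1" if "\<not> C \<subseteq># D"
  proof
    fix v
    show "count (D + C) v \<le> 1"
    proof (cases "v \<in># C")
      case True
      then have v: "v \<in> orbit shift u" using fin unfolding C by simp
      have "v \<notin># D"
      proof
        assume "v \<in># D"
        from shift_orbit_mset(2)[OF D(1) this] that show False
          unfolding C by (simp only: orbit_eq_of_mem[OF self(1) v])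
      qed
      then show ?thesis using countC[of v] by (simp add: not_in_iff)
    next
      case False
      then show ?thesis using D(3) by (simp add: not_in_iff)
    qed
  qed
qed

lemma toggle_involution:
  assumes x: "x \<in> (SIGMA \<alpha> : {\<alpha>. \<alpha> \<subseteq># \<gamma>}. odd_sets \<alpha> \<times> odd_multisets (\<gamma> - \<alpha>))" (is "_ \<in> ?P")
    and "\<gamma> \<noteq> {#}"
  shows "toggle x \<in> ?P" and "toggle (toggle x) = x"
    and "(-1) ^ size (snd (snd (toggle x))) = (- ((-1) ^ size (snd (snd x))) :: int)"
proof -
  obtain \<alpha> D Q where x_eq: "x = (\<alpha>, D, Q)" and \<alpha>: "\<alpha> \<subseteq># \<gamma>"
    and DO: "D \<in> odd_sets \<alpha>" "Q \<in> odd_multisets (\<gamma> - \<alpha>)"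
    using x by blast
  then have D: "image_mset shift D = D" "content D = \<alpha>" "\<forall>u\<in>#D. odd_period u" "\<forall>u. count D u \<le> 1"
    and Q: "image_mset shift Q = Q" "content Q = \<gamma> - \<alpha>" "\<forall>u\<in>#Q. odd_period u"
    by (auto simp: odd_sets_def odd_multisets_def shift_multisets_def)
  have \<gamma>: "content (D + Q) = \<gamma>" using D(2) Q(2) \<alpha> by simp
  \<comment> \<open>Nonempty content provides a word and hence an orbit to move.\<close>
  then have "D + Q \<noteq> {#}" using assms(2) by auto
  define C where "C = some_orbit (D + Q)"
  note C = some_orbit_props[OF DO \<open>D + Q \<noteq> {#}\<close>, folded C_def]
  \<comment> \<open>\<open>C\<close> depends on the sum alone, so the second application finds the
    same \<open>C\<close> and undoes the move.\<close>
  have toggle_eq: "toggle (\<alpha>', D', Q') =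
      (if C \<subseteq># D' then (content (D' - C), D' - C, Q' + C) else (content (D' + C), D' + C, Q' - C))"
    if "D' + Q' = D + Q" for \<alpha>' D' Q'
    by (simp only: toggle_def prod.case Let_def that C_def)
  have mem: "(content D', D', Q') \<in> ?P"
    if "image_mset shift D' = D'" "image_mset shift Q' = Q'" "D' + Q' = D + Q"
      "\<forall>u. count D' u \<le> 1" for D' Q'
  proof -
    have "content D' + content Q' = \<gamma>" using that(3) \<gamma> by (metis image_mset_union)
    then have "content Q' = \<gamma> - content D'" "content D' \<subseteq># \<gamma>"
      by (metis add_diff_cancel_left', metis mset_subset_eq_add_left)
    moreover have "\<forall>u\<in>#D'. odd_period u" "\<forall>u\<in>#Q'. odd_period u"
      using D(3) Q(3) that(3) by (metis union_iff)+
    ultimately show ?thesis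
      using that by (simp add: odd_sets_def odd_multisets_def shift_multisets_def)
  qed
  show "toggle x \<in> ?P" "toggle (toggle x) = x"
    "(-1) ^ size (snd (snd (toggle x))) = (- ((-1) ^ size (snd (snd x))) :: int)"
  proof -
    consider "C \<subseteq># D" | "\<not> C \<subseteq># D" by blast
    then have "toggle x \<in> ?P \<and> toggle (toggle x) = x \<and>
      (-1) ^ size (snd (snd (toggle x))) = (- ((-1) ^ size (snd (snd x))) :: int)"
    proof cases
      case 1
      have tx: "toggle x = (content (D - C), D - C, Q + C)"
        unfolding x_eq toggle_eq[OF refl] using 1 by (rule if_P)
      have sum: "D - C + (Q + C) = D + Q"
        using 1 by (metis add.assoc add.commute subset_mset.diff_add)
      have "toggle x \<in> ?P"
        unfolding tx
      proof (rule mem[OF _ _ sum])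
        show "image_mset shift (D - C) = D - C" by (rule image_shift_diff[OF D(1) C(1) 1])
        show "image_mset shift (Q + C) = Q + C" using Q(1) C(1) by simp
        show "\<forall>u. count (D - C) u \<le> 1" 
        proof
          fix v
          have "count (D - C) v \<le> count D v" by simp
          also have "\<dots> \<le> 1" using D(4) by blast
          finally show "count (D - C) v \<le> 1" .
        qed
      qed
      moreover have "toggle (toggle x) = x"
        unfolding tx toggle_eq[OF sum] using C(4)[OF 1] 1 by (simp add: D(2) x_eq)
      moreover have "(-1) ^ size (snd (snd (toggle x))) = (- ((-1) ^ size (snd (snd x))) :: int)"
        unfolding tx using C(2) by (simp add: power_add x_eq)
      ultimately show ?thesis by blast
    next
      case 2
      have tx: "toggle x = (content (D + C), D + C, Q - C)"
        unfolding x_eq toggle_eq[OF refl] using 2 by (rule if_not_P)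
      have sum: "D + C + (Q - C) = D + Q"
        using C(5)[OF 2] by (metis add.assoc add.commute subset_mset.diff_add)
      have "toggle x \<in> ?P"
        unfolding tx
      proof (rule mem[OF _ _ sum])
        show "image_mset shift (Q - C) = Q - C" by (rule image_shift_diff[OF Q(1) C(1) C(5)[OF 2]])
        show "image_mset shift (D + C) = D + C" using D(1) C(1) by simp
        show "\<forall>u. count (D + C) u \<le> 1" by (rule C(6)[OF 2])
      qed
      moreover have "toggle (toggle x) = x"
        unfolding tx toggle_eq[OF sum] using C(5)[OF 2] by (simp add: D(2) x_eq)
      moreover have "(-1) ^ size (snd (snd (toggle x))) = (- ((-1) ^ size (snd (snd x))) :: int)"
      proof -
        have "size Q = size (Q - C) + size C"
          using C(5)[OF 2] by (metis size_union subset_mset.diff_add)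
        then show ?thesis unfolding tx using C(2) by (simp add: power_add x_eq)
      qed
      ultimately show ?thesis by blast
    qed
    then show "toggle x \<in> ?P" "toggle (toggle x) = x"
      "(-1) ^ size (snd (snd (toggle x))) = (- ((-1) ^ size (snd (snd x))) :: int)"
      by blast+
  qed
qed

text \<open>Coefficient form of the cancellation of \<open>1 + x^N\<close> against
  \<open>1/(1 + x^N)\<close> over odd necklaces. The second factor carries the sign of the number of
  necklaces, which has the parity of the size since all of them are odd.\<close>

lemma odd_sets_convolution:
  fixes \<gamma> :: "nat multiset"
  assumes "\<gamma> \<noteq> {#}"
  shows "(\<Sum>\<alpha> | \<alpha> \<subseteq># \<gamma>. int (card (odd_sets \<alpha>)) *
      ((-1) ^ size (\<gamma> - \<alpha>) * int (card (odd_multisets (\<gamma> - \<alpha>))))) = 0"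
proof -
  let ?P = "SIGMA \<alpha> : {\<alpha>. \<alpha> \<subseteq># \<gamma>}. odd_sets \<alpha> \<times> odd_multisets (\<gamma> - \<alpha>)"
  let ?f = "\<lambda>x. (-1) ^ size (snd (snd x)) :: int"
  have "int (card (odd_sets \<alpha>)) * ((-1) ^ size (\<gamma> - \<alpha>) * int (card (odd_multisets (\<gamma> - \<alpha>)))) =
      (\<Sum>y\<in>odd_sets \<alpha> \<times> odd_multisets (\<gamma> - \<alpha>). ?f (\<alpha>, y))" for \<alpha>
  proof -
    have "(\<Sum>y\<in>odd_sets \<alpha> \<times> odd_multisets (\<gamma> - \<alpha>). ?f (\<alpha>, y)) =
        (\<Sum>y\<in>odd_sets \<alpha> \<times> odd_multisets (\<gamma> - \<alpha>). (-1) ^ size (\<gamma> - \<alpha>))"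
    proof (rule sum.cong[OF refl])
      fix y assume "y \<in> odd_sets \<alpha> \<times> odd_multisets (\<gamma> - \<alpha>)"
      then have "snd y \<in> shift_multisets (\<gamma> - \<alpha>)" by (auto simp: odd_multisets_def)
      from size_of_mem_shift_multisets[OF this]
      show "?f (\<alpha>, y) = (-1) ^ size (\<gamma> - \<alpha>)" by simp
    qed
    then show ?thesis by (simp add: card_cartesian_product)
  qed
  then have "(\<Sum>\<alpha> | \<alpha> \<subseteq># \<gamma>. int (card (odd_sets \<alpha>)) *
      ((-1) ^ size (\<gamma> - \<alpha>) * int (card (odd_multisets (\<gamma> - \<alpha>))))) =
      (\<Sum>\<alpha> | \<alpha> \<subseteq># \<gamma>. \<Sum>y\<in>odd_sets \<alpha> \<times> odd_multisets (\<gamma> - \<alpha>). ?f (\<alpha>, y))"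
    by simp
  also have "\<dots> = (\<Sum>(\<alpha>, y)\<in>?P. ?f (\<alpha>, y))"
    by (rule sum.Sigma) (simp_all add: finite_submultisets finite_odd_even_multisets)
  also have "\<dots> = sum ?f ?P" by (rule sum.cong) auto
  also have "\<dots> = 0"
    by (rule sum_sign_reversing_involution[where \<tau> = toggle]) (use toggle_involution[OF _ assms] in blast)
  finally show ?thesis .
qed

text \<open>The sign of all letters is changed in \<open>card_shift_multisets_convolution\<close>;
  even parts have even size, so only the odd part contributes to the sign.\<close>

lemma even_sum_convolution:
  fixes \<gamma> :: "nat multiset"
  shows "(\<Sum>\<alpha> | \<alpha> \<subseteq># \<gamma>. int (card (even_multisets \<alpha>)) *
      ((-1) ^ size (\<gamma> - \<alpha>) * int (card (odd_multisets (\<gamma> - \<alpha>))))) =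
    (-1) ^ size \<gamma> * int (card (shift_multisets \<gamma>))"
proof -
  have *: "int (card (even_multisets \<alpha>)) * ((-1) ^ size (\<gamma> - \<alpha>) * int (card (odd_multisets (\<gamma> - \<alpha>)))) =
      (-1) ^ size \<gamma> * int (card (even_multisets \<alpha>) * card (odd_multisets (\<gamma> - \<alpha>)))"
    if "\<alpha> \<subseteq># \<gamma>" for \<alpha>
  proof (cases "even_multisets \<alpha> = {}")
    case False
    then obtain M where "M \<in> even_multisets \<alpha>" by blast
    then have "even (size \<alpha>)"
      using even_size_of_even_periods[of M] size_of_mem_shift_multisets[of M \<alpha>]
      by (simp add: even_multisets_def shift_multisets_def)
    moreover have "size \<gamma> = size (\<gamma> - \<alpha>) + size \<alpha>"
      using that by (metis size_union subset_mset.diff_add)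
    ultimately show ?thesis by (simp add: power_add)
  qed simp
  show ?thesis
    unfolding card_shift_multisets_convolution[of \<gamma>] of_nat_sum sum_distrib_left
    by (rule sum.cong[OF refl]) (simp only: mem_Collect_eq *)
qed

text \<open>The pairs \<open>(\<alpha>, a)\<close> and \<open>(a, \<beta>)\<close> correspond by
  \<open>\<beta> = \<alpha> - {#a#}\<close>: multiplication by the sum of the letters passes through
  a convolution.\<close>

lemma sum_submultisets_remove:
  fixes F :: "'a multiset \<Rightarrow> 'a multiset \<Rightarrow> int"
  shows "(\<Sum>\<alpha> | \<alpha> \<subseteq># \<gamma>. \<Sum>a\<in>set_mset \<alpha>. F (\<alpha> - {#a#}) (\<gamma> - \<alpha>)) =
    (\<Sum>a\<in>set_mset \<gamma>. \<Sum>\<beta> | \<beta> \<subseteq># \<gamma> - {#a#}. F \<beta> (\<gamma> - {#a#} - \<beta>))"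
proof -
  have "(\<Sum>\<alpha> | \<alpha> \<subseteq># \<gamma>. \<Sum>a\<in>set_mset \<alpha>. F (\<alpha> - {#a#}) (\<gamma> - \<alpha>)) =
      (\<Sum>(\<alpha>, a)\<in>(SIGMA \<alpha> : {\<alpha>. \<alpha> \<subseteq># \<gamma>}. set_mset \<alpha>). F (\<alpha> - {#a#}) (\<gamma> - \<alpha>))"
    by (rule sum.Sigma) (simp_all add: finite_submultisets)
  also have "\<dots> = (\<Sum>(a, \<beta>)\<in>(SIGMA a : set_mset \<gamma>. {\<beta>. \<beta> \<subseteq># \<gamma> - {#a#}}). F \<beta> (\<gamma> - {#a#} - \<beta>))"
    by (rule sum.reindex_bij_witness[of _ "\<lambda>(a, \<beta>). (add_mset a \<beta>, a)" "\<lambda>(\<alpha>, a). (a, \<alpha> - {#a#})"])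
      (auto simp: insert_subset_eq_iff dest: mset_subset_eqD multi_member_split)
  also have "\<dots> = (\<Sum>a\<in>set_mset \<gamma>. \<Sum>\<beta> | \<beta> \<subseteq># \<gamma> - {#a#}. F \<beta> (\<gamma> - {#a#} - \<beta>))"
    by (rule sum.Sigma[symmetric]) (simp_all add: finite_submultisets)
  finally show ?thesis .
qed

text \<open>Coefficient form of the identity between the product of \<open>1 + x^N\<close> over odd
  necklaces and the even product times one plus the sum of the letters. Both sides are inverse to
  \<open>h\<close> under convolution, and \<open>h {#} = 1\<close> makes the inverse unique.\<close>

lemma card_odd_sets:
  fixes \<gamma> :: "nat multiset"
  shows "card (odd_sets \<gamma>) =
    card (even_multisets \<gamma>) + (\<Sum>a\<in>set_mset \<gamma>. card (even_multisets (\<gamma> - {#a#})))"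
proof -
  define d where "d = (\<lambda>\<gamma> :: nat multiset. int (card (odd_sets \<gamma>)))"
  define e where "e = (\<lambda>\<gamma> :: nat multiset. int (card (even_multisets \<gamma>)))"
  define h where "h = (\<lambda>\<gamma> :: nat multiset. (-1) ^ size \<gamma> * int (card (odd_multisets \<gamma>)))"
  define m where "m = (\<lambda>\<gamma> :: nat multiset. int (card (shift_multisets \<gamma>)))"
  define d' where "d' = (\<lambda>\<gamma>. e \<gamma> + (\<Sum>a\<in>set_mset \<gamma>. e (\<gamma> - {#a#})))"
  have empty: "shift_multisets {#} = {{#} :: (nat \<Rightarrow> nat) multiset}"
    by (auto simp: shift_multisets_def)
  then have h0: "h {#} = 1" and d0: "d {#} = d' {#}"
    by (simp_all add: h_def d_def d'_def e_def odd_multisets_def even_multisets_def odd_sets_def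
        Collect_conv_if cong: conj_cong)
  have conv_d: "(\<Sum>\<alpha> | \<alpha> \<subseteq># \<gamma>. d \<alpha> * h (\<gamma> - \<alpha>)) = 0" if "\<gamma> \<noteq> {#}" for \<gamma>
    using odd_sets_convolution[OF that] by (simp add: d_def h_def)
  have conv_e: "(\<Sum>\<alpha> | \<alpha> \<subseteq># \<gamma>. e \<alpha> * h (\<gamma> - \<alpha>)) = (-1) ^ size \<gamma> * m \<gamma>" for \<gamma>
    using even_sum_convolution[of \<gamma>] by (simp add: e_def h_def m_def)
  \<comment> \<open>Convolving \<open>e\<close> with \<open>h\<close> gives signed word counts; the
    terms with a letter removed give, by the recursion for words, the same amount with opposite
    sign.\<close>
  have conv_d': "(\<Sum>\<alpha> | \<alpha> \<subseteq># \<gamma>. d' \<alpha> * h (\<gamma> - \<alpha>)) = 0" if "\<gamma> \<noteq> {#}" for \<gamma>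
  proof -
    have "(\<Sum>\<alpha> | \<alpha> \<subseteq># \<gamma>. d' \<alpha> * h (\<gamma> - \<alpha>)) = (\<Sum>\<alpha> | \<alpha> \<subseteq># \<gamma>. e \<alpha> * h (\<gamma> - \<alpha>)) +
        (\<Sum>\<alpha> | \<alpha> \<subseteq># \<gamma>. \<Sum>a\<in>set_mset \<alpha>. e (\<alpha> - {#a#}) * h (\<gamma> - \<alpha>))"
      by (simp add: d'_def distrib_right sum.distrib sum_distrib_right)
    also have "(\<Sum>\<alpha> | \<alpha> \<subseteq># \<gamma>. \<Sum>a\<in>set_mset \<alpha>. e (\<alpha> - {#a#}) * h (\<gamma> - \<alpha>)) =
        (\<Sum>a\<in>set_mset \<gamma>. \<Sum>\<beta> | \<beta> \<subseteq># \<gamma> - {#a#}. e \<beta> * h (\<gamma> - {#a#} - \<beta>))"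
      by (rule sum_submultisets_remove)
    also have "\<dots> = (\<Sum>a\<in>set_mset \<gamma>. - ((-1) ^ size \<gamma>) * m (\<gamma> - {#a#}))"
    proof (rule sum.cong[OF refl])
      fix a assume "a \<in># \<gamma>"
      then have "size \<gamma> = Suc (size (\<gamma> - {#a#}))" by (metis insert_DiffM size_add_mset)
      then show "(\<Sum>\<beta> | \<beta> \<subseteq># \<gamma> - {#a#}. e \<beta> * h (\<gamma> - {#a#} - \<beta>)) = - ((-1) ^ size \<gamma>) * m (\<gamma> - {#a#})"
        unfolding conv_e by simp
    qed
    also have "\<dots> = - ((-1) ^ size \<gamma>) * m \<gamma>"
      unfolding sum_distrib_left[symmetric] m_def card_shift_multisets_rec[OF that] of_nat_sum ..
    finally show ?thesis unfolding conv_e by simp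
  qed
  have "d \<gamma> = d' \<gamma>" for \<gamma>
  proof (induction \<gamma> rule: measure_induct_rule[of size])
    case (less \<gamma>)
    show ?case
    proof (cases "\<gamma> = {#}")
      case False
      \<comment> \<open>The term for \<open>\<alpha> = \<gamma>\<close> has coefficient
        \<open>1\<close>, so the value at \<gamma> is determined by the values at smaller
        multisets.\<close>
      have split: "(\<Sum>\<alpha> | \<alpha> \<subseteq># \<gamma>. f \<alpha> * h (\<gamma> - \<alpha>)) = f \<gamma> + (\<Sum>\<alpha>\<in>{\<alpha>. \<alpha> \<subseteq># \<gamma>} - {\<gamma>}. f \<alpha> * h (\<gamma> - \<alpha>))" for f
        by (subst sum.remove[of _ \<gamma>]) (simp_all add: finite_submultisets h0)
      have "(\<Sum>\<alpha>\<in>{\<alpha>. \<alpha> \<subseteq># \<gamma>} - {\<gamma>}. d \<alpha> * h (\<gamma> - \<alpha>)) = (\<Sum>\<alpha>\<in>{\<alpha>. \<alpha> \<subseteq># \<gamma>} - {\<gamma>}. d' \<alpha> * h (\<gamma> - \<alpha>))"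
      proof (rule sum.cong[OF refl])
        fix \<alpha> assume "\<alpha> \<in> {\<alpha>. \<alpha> \<subseteq># \<gamma>} - {\<gamma>}"
        then have "size \<alpha> < size \<gamma>"
          by (intro mset_subset_size) (simp add: subset_mset.less_le)
        then show "d \<alpha> * h (\<gamma> - \<alpha>) = d' \<alpha> * h (\<gamma> - \<alpha>)" using less by simp
      qed
      then show ?thesis
        using conv_d[OF False] conv_d'[OF False] unfolding split by simp
    qed (simp add: d0)
  qed
  from this[of \<gamma>] have "int (card (odd_sets \<gamma>)) =
      int (card (even_multisets \<gamma>) + (\<Sum>a\<in>set_mset \<gamma>. card (even_multisets (\<gamma> - {#a#}))))"
    by (simp add: d_def d'_def e_def)
  then show ?thesis by (simp only: of_nat_eq_iff)
qed

text \<open>A constant word forming the whole odd part can be split off, leaving an even multiset;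
  its letter is read off from the odd part, so different letters give disjoint sets.\<close>

lemma card_even_multisets_with_fixed_word:
  fixes \<gamma> :: "nat multiset"
  shows "card {M \<in> shift_multisets \<gamma>. filter_mset odd_period M = {#} \<or>
      (\<exists>a. filter_mset odd_period M = {#\<lambda>_. a#})} =
    card (even_multisets \<gamma>) + (\<Sum>a\<in>set_mset \<gamma>. card (even_multisets (\<gamma> - {#a#})))"
    (is "card ?B = _")
proof -
  let ?G = "\<lambda>a. add_mset (\<lambda>_. a) ` even_multisets (\<gamma> - {#a#})"
  have const: "odd_period (\<lambda>_. a)" "shift (\<lambda>_. a) = (\<lambda>_. a)" for a :: nat
    unfolding odd_period_def shift_def by (auto intro!: exI[of _ 1])
  have filter_G: "filter_mset odd_period M = {#\<lambda>_. a#}" if "M \<in> ?G a" for M a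
    using that const by (auto simp: even_multisets_def)
  have B: "?B = even_multisets \<gamma> \<union> (\<Union>a\<in>set_mset \<gamma>. ?G a)"
  proof (intro antisym subsetI)
    fix M assume M: "M \<in> ?B"
    then have inv: "image_mset shift M = M" "content M = \<gamma>" by (auto simp: shift_multisets_def)
    from M consider "filter_mset odd_period M = {#}" | a where "filter_mset odd_period M = {#\<lambda>_. a#}"
      by blast
    then show "M \<in> even_multisets \<gamma> \<union> (\<Union>a\<in>set_mset \<gamma>. ?G a)"
    proof cases
      case 1
      then have "M \<in> even_multisets \<gamma>"
        using M by (simp add: even_multisets_def)
      then show ?thesis by blast
    next
      case 2
      let ?E = "filter_mset (\<lambda>u. \<not> odd_period u) M"
      have ME: "M = add_mset (\<lambda>_. a) ?E"
        using multiset_partition[of M odd_period] 2 by simp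
      have \<gamma>: "\<gamma> = add_mset a (content ?E)"
        using arg_cong[OF ME, of content] inv(2) by (simp only: image_mset_add_mset)
      have "?E \<in> even_multisets (\<gamma> - {#a#})"
        using image_shift_filter(2)[OF inv(1)] \<gamma>
        by (simp add: even_multisets_def shift_multisets_def)
      moreover have "a \<in># \<gamma>" by (subst \<gamma>) simp
      ultimately show ?thesis using ME by blast
    qed
  next
    fix M assume "M \<in> even_multisets \<gamma> \<union> (\<Union>a\<in>set_mset \<gamma>. ?G a)"
    then consider "M \<in> even_multisets \<gamma>" | a where "a \<in># \<gamma>" "M \<in> ?G a" by blast
    then show "M \<in> ?B"
    proof cases
      case 1
      then show ?thesis by (auto simp: even_multisets_def)
    next
      case 2
      then have "M \<in> shift_multisets \<gamma>"
        using const(2) by (auto simp: even_multisets_def shift_multisets_def)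
      then show ?thesis using filter_G[OF 2(2)] by blast
    qed
  qed
  have "card ?B = card (even_multisets \<gamma>) + card (\<Union>a\<in>set_mset \<gamma>. ?G a)"
    unfolding B
  proof (rule card_Un_disjoint)
    have "M \<notin> even_multisets \<gamma>" if "M \<in> ?G a" for M a
      using that const(1) by (auto simp: even_multisets_def)
    then show "even_multisets \<gamma> \<inter> (\<Union>a\<in>set_mset \<gamma>. ?G a) = {}" by blast
  qed (simp_all add: finite_odd_even_multisets)
  also have "card (\<Union>a\<in>set_mset \<gamma>. ?G a) = (\<Sum>a\<in>set_mset \<gamma>. card (?G a))"
  proof (rule card_UN_disjoint)
    show "\<forall>a\<in>set_mset \<gamma>. \<forall>b\<in>set_mset \<gamma>. a \<noteq> b \<longrightarrow> ?G a \<inter> ?G b = {}"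
    proof (intro ballI impI)
      fix a b :: nat assume "a \<noteq> b"
      then have ne: "{#\<lambda>_ :: nat. a#} \<noteq> {#\<lambda>_. b#}" by (simp add: fun_eq_iff)
      have "M \<notin> ?G b" if "M \<in> ?G a" for M
        using filter_G[OF that] filter_G[of M b] ne by (simp only:) blast
      then show "?G a \<inter> ?G b = {}" by blast
    qed
  qed (simp_all add: finite_odd_even_multisets)
  also have "\<dots> = (\<Sum>a\<in>set_mset \<gamma>. card (even_multisets (\<gamma> - {#a#})))"
    by (intro sum.cong refl card_image inj_onI) simp
  finally show ?thesis .
qed

theorem theorem1p2:
  fixes n :: nat and S :: "nat set"
  assumes "n \<ge> 1" and "S \<subseteq> {1..n-1}"
  shows "\<exists>f. bij_betw f {p \<in> odd_perms n. Asc n p \<subseteq> S}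
                       {p \<in> even_perms n. Des n p \<subseteq> S}"
proof -
  have "finite S" using assms(2) finite_subset by blast
  \<comment> \<open>Both sides are counted at the same content, the multiset of block labels, where
    both counts reduce to the same expression in \<open>even_multisets\<close>.\<close>
  then have "card {p \<in> odd_perms n. Asc n p \<subseteq> S} = card {p \<in> even_perms n. Des n p \<subseteq> S}"
    by (simp only: card_odd_perms card_even_perms card_odd_sets card_even_multisets_with_fixed_word)
  moreover have "finite {p. p permutes {1..n}}"
    by (rule finite_permutations) simp
  then have "finite {p \<in> odd_perms n. Asc n p \<subseteq> S}" "finite {p \<in> even_perms n. Des n p \<subseteq> S}"
    by (auto simp: odd_perms_def even_perms_def perms_def elim: rev_finite_subset)
  ultimately show ?thesis
    by (rule finite_same_card_bij[rotated 2, of "{p \<in> odd_perms n. Asc n p \<subseteq> S}"])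
qed

end
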